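(* Let $g(t,x)$ be a weak solution of the linear Boltzmann-type equation described in the context (with $\eta=1$), with microscopic interaction $x' = x + \lambda (x^{\alpha}(t,\vec{\mathbf y}) - x) + \sigma D(t,x,\vec{\mathbf y})\xi$ and initial datum $g_0$. Suppose: (A1) for every $\mathbf y\in E$ there are constants $\underline F(\mathbf y),\overline F(\mathbf y)\in\mathbb R$ with $\underline F(\mathbf y)\le F(x,\mathbf y)\le \overline F(\mathbf y)$ for all $x\in\mathbb R^d$; (A2) for every $\mathbf y\in E$, $F(\cdot,\mathbf y)\in C^2(\mathbb R^d,\mathbb R)$ and there are constants $c_1(\mathbf y),c_2(\mathbf y)>0$ with $\sup_{x}|\nabla_xF(x,\mathbf y)|\le c_1(\mathbf y)$ and $\sup_x|\nabla_x^2F(x,\mathbf y)|\le c_2(\mathbf y)$, where $\nabla_x^2$ denotes the Hessian in $x$. Set $\underline f=\int_E\underline F(\mathbf y)\,d\nu^{\mathbf Y}(\mathbf y)$, $c_i=\int_E c_i(\mathbf y)\,d\nu^{\mathbf Y}(\mathbf y)$ for $i=1,2$, and $\|\omega^{\alpha,f}\|_{L^1(g_0)}=\int_{\mathbb R^d}e^{-\alpha f(x)}g_0(x)\,dx$. Assume that $\lambda,\sigma,\alpha,\kappa$ and $g_0$ satisfy $$\mu:=2\lambda-2(\lambda^2+\kappa\sigma^2)C_\alpha>0,$$ $$\nu:=\frac{2}{\mu\,\|\omega^{\alpha,f}\|_{L^1(g_0)}}\,\alpha e^{-\alpha\underline f}\left(2\lambda c_1\sqrt{C_\alpha}+(\lambda^2+\kappa\sigma^2)c_2C_\alpha\right)\max\{\sqrt{V(0)},V(0)\}<\frac12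 .$$ Then there exists $\tilde x\in\mathbb R^d$ such that $m(t)\to\tilde x$ as $t\to+\infty$, and $$f(\tilde x)\le f(x_{\min})+r(\alpha)+\frac{\log 2}{\alpha},\qquad r(\alpha):=-\frac1\alpha\log\|\omega^{\alpha,f}\|_{L^1(g_0)}-f(x_{\min}),$$ where $r(\alpha)\to0$ as $\alpha\to\infty$ if $x_{\min}\in\operatorname{supp}(g_0)$.
   Context: Optimization problem. $\mathbf Y$ is a random vector on a probability space $(\Omega,\mathcal A,\mathbb P)$ with values in $E\subset\mathbb R^k$ and law $\nu^{\mathbf Y}$. $F:\mathbb R^d\times E\to\mathbb R$ is such that, for each $x$, $F(x,\cdot)$ is measurable and $f(x):=\mathbb E_{\mathbb P}[F(x,\mathbf Y)]=\int_EF(x,\mathbf y)\,d\nu^{\mathbf Y}(\mathbf y)$ is finite. It is assumed that $f$ has a global minimizer $x_{\min}\in\mathbb R^d$. Samples. Fix $M\in\mathbb N$. For $\vec{\mathbf y}=(\mathbf y^{(1)},\dots,\mathbf y^{(M)})\in E^M$ let $\hat f_M(x,\vec{\mathbf y})=\frac1M\sum_{j=1}^MF(x,\mathbf y^{(j)})$. Samples $\vec{\mathbf y}$ of $M$ realizations of $\mathbf Y$ are drawn from a fixed probability law on $E^M$ with density $\theta$. Interaction. $\lambda,\sigma,\alpha>0$ are constants. Given a time-dependent probability density $g(t,\cdot)$ on $\mathbb R^d$, $$x^\alpha(t,\vec{\mathbf y})=\frac{\int_{\mathbb R^d}x\,e^{-\alpha\hat f_M(x,\vec{\mathbf y})}g(t,x)\,dx}{\int_{\mathbb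 R^d}e^{-\alpha\hat f_M(x,\vec{\mathbf y})}g(t,x)\,dx}.$$ The matrix $D(t,x,\vec{\mathbf y})\in\mathbb R^{d\times d}$ is either isotropic, $D=|x^\alpha(t,\vec{\mathbf y})-x|I_d$, in which case $\kappa:=d$, or anisotropic, $D=\operatorname{diag}(x^\alpha(t,\vec{\mathbf y})-x)$, in which case $\kappa:=1$. The vector $\xi\sim\mathcal N(0,I_d)$ is independent of $\vec{\mathbf y}$, and $\langle\cdot\rangle$ denotes expectation in $\xi$. The post-interaction position is $x'=x+\lambda(x^\alpha(t,\vec{\mathbf y})-x)+\sigma D(t,x,\vec{\mathbf y})\xi$. Weak solution (with interaction scale $\eta=1$). $g$ is a weak solution with initial datum $g_0$ (a probability density) if, for test functions $\psi$ and $t>0$, $$\frac{d}{dt}\int_{\mathbb R^d}\psi(x)g(t,x)\,dx=\int_{\mathbb R^d\times E^M}\langle\psi(x')-\psi(x)\rangle\,g(t,x)\,\theta(\vec{\mathbf y})\,dx\,d\vec{\mathbf y},$$ and $\lim_{t\to0}\int\psi(x)g(t,x)\,dx=\int\psi(x)g_0(x)\,dx$. Test functions are smooth, and $g$ is assumed to be sufficiently regular and integrable; in particular the identity may be used with $\psi(x)=x$, $\psi(x)=|x|^2$ and $\psi(x)=e^{-\alpha f(x)}$, and first and second moments are finite and continuous up to $t=0$. Moments. $m(t)=\int_{\mathbb R^d}x\,g(t,x)\,dx$ and $V(t)=\frac12\int_{\mathbb R^d}|x-m(t)|^2g(t,x)\,dx$, with $m(0),V(0)$ computed from $g_0$. Constant.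 $C_\alpha=\int_{E^M}e^{\alpha(\overline f_M(\vec{\mathbf y})-\underline f_M(\vec{\mathbf y}))}\theta(\vec{\mathbf y})\,d\vec{\mathbf y}>0$, where $\underline f_M(\vec{\mathbf y})=\frac1M\sum_{j=1}^M\underline F(\mathbf y^{(j)})$ and $\overline f_M(\vec{\mathbf y})=\frac1M\sum_{j=1}^M\overline F(\mathbf y^{(j)})$. The functions $\underline F,\overline F,c_1(\cdot),c_2(\cdot)$ are taken measurable, and $C_\alpha$, $\underline f$, $c_1$, $c_2$ are finite. *)

theory Defs
  imports "HOL-Probability.Probability"
begin

definition partial_deriv :: "'d::finite \<Rightarrow> (real^'d \<Rightarrow> real) \<Rightarrow> real^'d \<Rightarrow> real" where
  "partial_deriv i h x = frechet_derivative h (at x) (axis i 1)"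

definition grad :: "(real^'d \<Rightarrow> real) \<Rightarrow> real^'d \<Rightarrow> real^'d::finite" where
  "grad h x = (\<chi> i. partial_deriv i h x)"

definition hessian :: "(real^'d \<Rightarrow> real) \<Rightarrow> real^'d \<Rightarrow> real^'d^'d::finite" where
  "hessian h x = jacobian (grad h) (at x)"

primrec C_times :: "nat \<Rightarrow> (real^'d::finite \<Rightarrow> real) \<Rightarrow> bool" where
  "C_times 0 h \<longleftrightarrow> continuous_on UNIV h"
| "C_times (Suc n) h \<longleftrightarrow> (\<forall>x. h differentiable (at x)) \<and> (\<forall>i. C_times n (partial_deriv i h))"

definition smooth :: "(real^'d::finite \<Rightarrow> real) \<Rightarrow> bool" where
  "smooth h \<longleftrightarrow> (\<forall>n. C_times n h)"

definition prob_density :: "('a::euclidean_space \<Rightarrow> real) \<Rightarrow> bool" where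
  "prob_density p \<longleftrightarrow> p \<in> borel_measurable borel \<and> (\<forall>x. 0 \<le> p x)
     \<and> integrable lborel p \<and> (\<integral>x. p x \<partial>lborel) = 1"

text \<open>The support of the measure with density \<open>p\<close>; it does not change when \<open>p\<close> is
  modified on a null set.\<close>

definition density_support :: "('a::euclidean_space \<Rightarrow> real) \<Rightarrow> 'a set" where
  "density_support p = {x. \<forall>U. open U \<and> x \<in> U \<longrightarrow> 0 < (LINT z:U|lborel. p z)}"

definition density_mean :: "(real^'d \<Rightarrow> real) \<Rightarrow> real^'d::finite" where
  "density_mean p = (\<integral>x. p x *\<^sub>R x \<partial>lborel)"

definition density_V :: "(real^'d::finite \<Rightarrow> real) \<Rightarrow> real" where
  "density_V p = 1/2 * (\<integral>x. (norm (x - density_mean p))\<^sup>2 * p x \<partial>lborel)"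

text \<open>A vector of \<open>M\<close> samples is an element of \<open>real^'k^'m\<close> with \<open>M = CARD('m)\<close>.\<close>

definition samples :: "(real^'k) set \<Rightarrow> (real^'k^'m::finite) set" where
  "samples E = {ys. \<forall>j. ys $ j \<in> E}"

text \<open>A density on \<open>E\<^sup>M\<close> is extended by zero, so that integrating a function against it over
  \<open>E\<^sup>M\<close> is the same as integrating over the whole space. This needs no
  assumption on the set \<open>E\<close>.\<close>

definition sample_density :: "(real^'k) set \<Rightarrow> (real^'k^'m::finite \<Rightarrow> real) \<Rightarrow> bool" where
  "sample_density E \<theta> \<longleftrightarrow> prob_density \<theta> \<and> (\<forall>ys. ys \<notin> samples E \<longrightarrow> \<theta> ys = 0)"

definition sample_avg :: "(real^'k \<Rightarrow> real) \<Rightarrow> real^'k^'m::finite \<Rightarrow> real" where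
  "sample_avg h ys = 1 / real CARD('m) * (\<Sum>j\<in>UNIV. h (ys $ j))"

definition exp_gap_const ::
  "real \<Rightarrow> (real^'k \<Rightarrow> real) \<Rightarrow> (real^'k \<Rightarrow> real) \<Rightarrow> (real^'k^'m::finite \<Rightarrow> real) \<Rightarrow> real" where
  "exp_gap_const \<alpha> Flo Fhi \<theta> =
     (\<integral>ys. exp (\<alpha> * (sample_avg Fhi ys - sample_avg Flo ys)) * \<theta> ys \<partial>lborel)"

definition consensus ::
  "real \<Rightarrow> (real^'d \<Rightarrow> real^'k \<Rightarrow> real) \<Rightarrow> (real^'d \<Rightarrow> real) \<Rightarrow> real^'k^'m::finite \<Rightarrow> real^'d::finite" where
  "consensus \<alpha> F p ys =
     (1 / (\<integral>x. exp (- \<alpha> * sample_avg (F x) ys) * p x \<partial>lborel)) *\<^sub>R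
     (\<integral>x. (exp (- \<alpha> * sample_avg (F x) ys) * p x) *\<^sub>R x \<partial>lborel)"

text \<open>The diffusion matrix as a function of the displacement \<open>v = x\<^sup>\<alpha> - x\<close>.\<close>

definition isotropic :: "real^'d \<Rightarrow> real^'d^'d::finite" where
  "isotropic v = mat (norm v)"

definition anisotropic :: "real^'d \<Rightarrow> real^'d^'d::finite" where
  "anisotropic v = (\<chi> i j. if i = j then v $ i else 0)"

definition post_position ::
  "real \<Rightarrow> real \<Rightarrow> (real^'d \<Rightarrow> real^'d^'d) \<Rightarrow> real^'d \<Rightarrow> real^'d \<Rightarrow> real^'d \<Rightarrow> real^'d::finite" where
  "post_position lam sig D xa x \<xi> = x + lam *\<^sub>R (xa - x) + sig *\<^sub>R (D (xa - x) *v \<xi>)"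

definition std_gaussian :: "(real^'d::finite) measure" where
  "std_gaussian = density lborel (\<lambda>\<xi>. ennreal (\<Prod>i\<in>UNIV. std_normal_density (\<xi> $ i)))"

text \<open>The integrand of the collision operator; the inner integral is the expectation over the
  Gaussian noise alone, which is independent of the samples.\<close>

definition collision_integrand ::
  "real \<Rightarrow> real \<Rightarrow> real \<Rightarrow> (real^'d \<Rightarrow> real^'d^'d) \<Rightarrow> (real^'d \<Rightarrow> real^'k \<Rightarrow> real) \<Rightarrow>
   (real^'k^'m::finite \<Rightarrow> real) \<Rightarrow> (real^'d \<Rightarrow> real) \<Rightarrow> (real^'d::finite \<Rightarrow> real) \<Rightarrow>
   ((real^'d) \<times> (real^'k^'m)) \<Rightarrow> real" where
  "collision_integrand lam sig \<alpha> D F \<theta> p \<psi> = (\<lambda>(x, ys).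
     (\<integral>\<xi>. \<psi> (post_position lam sig D (consensus \<alpha> F p ys) x \<xi>) - \<psi> x \<partial>std_gaussian) * p x * \<theta> ys)"

text \<open>Smooth test functions, together with those specific unbounded or merely
  \<open>C\<^sup>2\<close> functions for which the weak formulation is assumed to be usable. The
  coordinates and the squared norm also encode that first and second moments are finite and
  continuous up to the initial time.\<close>

definition test_functions ::
  "real \<Rightarrow> (real^'d \<Rightarrow> real) \<Rightarrow> (real^'d::finite \<Rightarrow> real) set" where
  "test_functions \<alpha> f =
     {\<psi>. smooth \<psi> \<and> compact (closure {x. \<psi> x \<noteq> 0})}
     \<union> range (\<lambda>i x. x $ i)
     \<union> {\<lambda>x. (norm x)\<^sup>2, \<lambda>x. exp (- \<alpha> * f x)}"

text \<open>Only the values \<open>g t\<close> for \<open>t > 0\<close> matter; the initial datum is \<open>g0\<close>.\<close>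

definition weak_solution ::
  "real \<Rightarrow> real \<Rightarrow> real \<Rightarrow> (real^'d \<Rightarrow> real^'d^'d) \<Rightarrow> (real^'d \<Rightarrow> real^'k \<Rightarrow> real) \<Rightarrow>
   (real^'k^'m::finite \<Rightarrow> real) \<Rightarrow> (real^'d::finite \<Rightarrow> real) set \<Rightarrow>
   (real^'d \<Rightarrow> real) \<Rightarrow> (real \<Rightarrow> real^'d \<Rightarrow> real) \<Rightarrow> bool" where
  "weak_solution lam sig \<alpha> D F \<theta> T g0 g \<longleftrightarrow>
     prob_density g0 \<and> (\<forall>t>0. prob_density (g t)) \<and>
     (\<forall>\<psi>\<in>T. integrable lborel (\<lambda>x. \<psi> x * g0 x) \<and>
       (\<forall>t>0. integrable lborel (\<lambda>x. \<psi> x * g t x) \<and>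
          integrable (lborel \<Otimes>\<^sub>M lborel) (collision_integrand lam sig \<alpha> D F \<theta> (g t) \<psi>) \<and>
          ((\<lambda>s. \<integral>x. \<psi> x * g s x \<partial>lborel) has_real_derivative
             (\<integral>z. collision_integrand lam sig \<alpha> D F \<theta> (g t) \<psi> z \<partial>(lborel \<Otimes>\<^sub>M lborel))) (at t)) \<and>
       ((\<lambda>t. \<integral>x. \<psi> x * g t x \<partial>lborel) \<longlongrightarrow> (\<integral>x. \<psi> x * g0 x \<partial>lborel)) (at_right 0))"

definition weight_norm :: "real \<Rightarrow> (real^'d \<Rightarrow> real) \<Rightarrow> (real^'d::finite \<Rightarrow> real) \<Rightarrow> real" where
  "weight_norm \<alpha> f g0 = (\<integral>x. exp (- \<alpha> * f x) * g0 x \<partial>lborel)"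

definition laplace_gap ::
  "(real^'d \<Rightarrow> real) \<Rightarrow> (real^'d \<Rightarrow> real) \<Rightarrow> real^'d::finite \<Rightarrow> real \<Rightarrow> real" where
  "laplace_gap f g0 xmin \<alpha> = - (1 / \<alpha>) * ln (weight_norm \<alpha> f g0) - f xmin"

end

theory Submission
  imports Defs
begin

text \<open>
The argument follows three quantities along the solution: the mean \<open>m(t)\<close>, the variance
  \<open>V(t)\<close> and the Gibbs weight \<open>W(t) = \<integral> exp (- \<alpha> f(x)) g(t,x) dx\<close>. Write \<open>X(ys)\<close> for the consensus
  point \<open>x\<^sup>\<alpha>(t, ys)\<close> and \<open>k = lam\<^sup>2 + \<kappa> sig\<^sup>2\<close>. The Gaussian noise has mean zero, and both diffusion
  matrices satisfy \<open>\<langle>|D \<xi>|\<^sup>2\<rangle> = \<kappa> |X - x|\<^sup>2\<close>; so one interaction moves \<open>x\<close> by \<open>lam (X - x)\<close> on average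
  and by \<open>k |X - x|\<^sup>2\<close> in mean square.

  Everything is controlled by the averages of \<open>|X - x|\<close> and \<open>|X - x|\<^sup>2\<close> over positions and samples.
  The point \<open>X\<close> is the barycentre of the density \<open>g(t)\<close> reweighted by a factor whose values differ
  by a ratio of at most \<open>exp (\<alpha> (fhi - flo))\<close>, where \<open>flo\<close> and \<open>fhi\<close> bound the sampled cost. Hence \<open>|X - x|\<^sup>2\<close> is at
  most this factor times the second moment about \<open>x\<close> (\<open>consensus_dist_le\<close>); averaging gives at
  most \<open>4 V C\<^sub>\<alpha>\<close> (\<open>displacement_square_le\<close>) and, by Cauchy--Schwarz, \<open>2 \<surd>(V C\<^sub>\<alpha>)\<close> for the first power.

  With the weak formulation this yields \<open>V' \<le> - \<mu> V\<close>, hence \<open>V(t) \<le> V(0) exp (- \<mu> t)\<close>, and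
  \<open>|m\<^sub>i'| \<le> 2 lam \<surd>(V C\<^sub>\<alpha>)\<close>, which is integrable in time, so that \<open>m(t)\<close> converges to some point
  \<open>xt\<close>. For \<open>W\<close>, the second-order bound \<open>f(x + u) \<le> f(x) + G \<bullet> u + c\<^sub>2 |u|\<^sup>2 / 2\<close> and \<open>exp s \<ge> 1 + s\<close> give
  \<open>exp (- \<alpha> f(x + u)) \<ge> exp (- \<alpha> f(x)) (1 - \<alpha> (G \<bullet> u + c\<^sub>2 |u|\<^sup>2 / 2))\<close>, which turns the bounds on
  \<open>f\<close> directly into a bound on the loss of weight in one interaction
  (\<open>collision_exp_lower_bound\<close>). Integrating the resulting bound on \<open>W'\<close> in time loses at most \<open>\<nu> W(0)\<close>, and therefore \<open>W(t) \<ge> W(0) / 2\<close> for all \<open>t\<close>. As the variance vanishes,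
  the density concentrates at \<open>xt\<close> and \<open>exp (- \<alpha> f(xt)) \<ge> W(0) / 2\<close>; taking logarithms is the
  claimed bound. The gap \<open>r(\<alpha>)\<close> tends to zero by the Laplace principle (\<open>laplace_principle\<close>).
\<close>

section \<open>Moments of weighted measures\<close>

text \<open>From \<open>|u| \<le> 1 + u\<^sup>2\<close>.\<close>

lemma integrable_of_second_moment:
  fixes u \<rho> :: "'a \<Rightarrow> real"
  assumes "integrable M \<rho>" "\<And>x. 0 \<le> \<rho> x" "(\<lambda>x. u x * \<rho> x) \<in> borel_measurable M"
    "integrable M (\<lambda>x. (u x)\<^sup>2 * \<rho> x)"
  shows "integrable M (\<lambda>x. u x * \<rho> x)"
proof (rule Bochner_Integration.integrable_bound)
  show "integrable M (\<lambda>x. \<rho> x + (u x)\<^sup>2 * \<rho> x)" using assms by simp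
  have "norm (u x * \<rho> x) \<le> norm (\<rho> x + (u x)\<^sup>2 * \<rho> x)" for x
  proof -
    have "2 * \<bar>u x\<bar> \<le> 1 + (u x)\<^sup>2"
      using zero_le_power2[of "\<bar>u x\<bar> - 1"] by (simp add: power2_diff)
    moreover have "0 \<le> (u x)\<^sup>2" by simp
    ultimately have "\<bar>u x\<bar> \<le> 1 + (u x)\<^sup>2" by linarith
    from mult_right_mono[OF this assms(2)[of x]] show ?thesis
      using assms(2)[of x] by (simp add: abs_mult distrib_right)
  qed
  then show "AE x in M. norm (u x * \<rho> x) \<le> norm (\<rho> x + (u x)\<^sup>2 * \<rho> x)" by simp
qed (rule assms(3))

text \<open>The variance of \<open>u\<close> under the probability density \<open>\<rho>\<close> is nonnegative.\<close>

lemma integral_le_sqrt_second_moment: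
  fixes u \<rho> :: "'a \<Rightarrow> real"
  assumes \<rho>: "integrable M \<rho>" "\<And>x. 0 \<le> \<rho> x" "(\<integral>x. \<rho> x \<partial>M) = 1"
    and u: "integrable M (\<lambda>x. u x * \<rho> x)" "integrable M (\<lambda>x. (u x)\<^sup>2 * \<rho> x)"
  shows "(\<integral>x. u x * \<rho> x \<partial>M) \<le> sqrt (\<integral>x. (u x)\<^sup>2 * \<rho> x \<partial>M)"
proof -
  define a where "a = (\<integral>x. u x * \<rho> x \<partial>M)"
  have "0 \<le> (\<integral>x. (u x - a)\<^sup>2 * \<rho> x \<partial>M)"
    by (intro integral_nonneg_AE) (auto simp: \<rho>)
  also have "\<dots> = (\<integral>x. (u x)\<^sup>2 * \<rho> x - (2 * a) * (u x * \<rho> x) + a\<^sup>2 * \<rho> x \<partial>M)"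
    by (intro Bochner_Integration.integral_cong) (auto simp: power2_eq_square algebra_simps)
  also have "\<dots> = (\<integral>x. (u x)\<^sup>2 * \<rho> x \<partial>M) - a\<^sup>2"
    using assms by (simp add: a_def[symmetric]) (simp add: power2_eq_square)
  finally show ?thesis unfolding a_def[symmetric]
    by (intro real_le_rsqrt) simp
qed

text \<open>The parallel axis theorem: replacing the barycentre \<open>c\<close> of the weight by another reference point
  \<open>a\<close> adds the total mass times \<open>|c - a|\<^sup>2\<close>. It serves both for the density itself and for its
  reweighting by the sampled Gibbs factor.\<close>

lemma second_moment_about:
  fixes w :: "'a::euclidean_space \<Rightarrow> real"
  assumes w: "integrable M w" "integrable M (\<lambda>x. w x *\<^sub>R x)"
    "integrable M (\<lambda>x. (norm x)\<^sup>2 * w x)"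
    and c: "(\<integral>x. w x *\<^sub>R x \<partial>M) = (\<integral>x. w x \<partial>M) *\<^sub>R c"
  shows "integrable M (\<lambda>x. (norm (x - a))\<^sup>2 * w x)" (is ?int)
    and "(\<integral>x. (norm (x - a))\<^sup>2 * w x \<partial>M)
      = (\<integral>x. (norm (x - c))\<^sup>2 * w x \<partial>M) + (\<integral>x. w x \<partial>M) * (norm (c - a))\<^sup>2" (is ?eq)
proof -
  have expand: "(\<lambda>x. (norm (x - b))\<^sup>2 * w x)
    = (\<lambda>x. (norm x)\<^sup>2 * w x - 2 * ((w x *\<^sub>R x) \<bullet> b) + (norm b)\<^sup>2 * w x)" for b
    by (rule ext) (simp add: power2_norm_eq_inner inner_diff inner_commute algebra_simps)
  have int: "integrable M (\<lambda>x. 2 * ((w x *\<^sub>R x) \<bullet> b))" for b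
    using w(2) by (intro integrable_mult_right integrable_inner_left) auto
  show ?int unfolding expand using w int by auto
  have val: "(\<integral>x. (norm (x - b))\<^sup>2 * w x \<partial>M)
    = (\<integral>x. (norm x)\<^sup>2 * w x \<partial>M) - 2 * (\<integral>x. w x \<partial>M) * (c \<bullet> b) + (norm b)\<^sup>2 * (\<integral>x. w x \<partial>M)" for b
  proof -
    have "(\<integral>x. 2 * ((w x *\<^sub>R x) \<bullet> b) \<partial>M) = 2 * ((\<integral>x. w x *\<^sub>R x \<partial>M) \<bullet> b)"
      using w(2) by (subst integral_mult_right_zero) (subst integral_inner_left, auto)
    then show ?thesis unfolding expand using w int[of b] c
      by (subst Bochner_Integration.integral_add)
         (auto simp: Bochner_Integration.integral_diff)
  qed
  show ?eq unfolding val
    by (simp add: power2_norm_eq_inner inner_diff inner_commute algebra_simps)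
qed

lemma has_bochner_integral_pair_times:
  fixes f :: "'a \<Rightarrow> real" and h :: "'b \<Rightarrow> real"
  assumes "sigma_finite_measure M" "sigma_finite_measure N"
    and f: "integrable M f" and h: "integrable N h"
  shows "has_bochner_integral (M \<Otimes>\<^sub>M N) (\<lambda>(x, y). f x * h y) ((\<integral>x. f x \<partial>M) * (\<integral>y. h y \<partial>N))"
proof -
  interpret pair_sigma_finite M N using assms(1,2) by (rule pair_sigma_finite.intro)
  have [measurable]: "f \<in> borel_measurable M" "h \<in> borel_measurable N" using f h by auto
  have i: "integrable (M \<Otimes>\<^sub>M N) (\<lambda>(x, y). f x * h y)"
  proof (rule Fubini_integrable)
    show "integrable M (\<lambda>x. \<integral>y. norm (case (x, y) of (x, y) \<Rightarrow> f x * h y) \<partial>N)"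
      using f by (simp add: abs_mult)
  qed (use h in auto)
  have "(\<integral>x. (\<integral>y. f x * h y \<partial>N) \<partial>M) = integral\<^sup>L (M \<Otimes>\<^sub>M N) (\<lambda>(x, y). f x * h y)"
    by (rule integral_fst[OF i])
  then show ?thesis using i by (simp add: has_bochner_integral_iff)
qed

lemma has_bochner_integral_le:
  fixes f g :: "'a \<Rightarrow> real"
  assumes "has_bochner_integral M f a" "has_bochner_integral M g b" "\<And>x. f x \<le> g x"
  shows "a \<le> b"
  using integral_mono[of M f g] assms by (simp add: has_bochner_integral_iff)

lemma integrable_position:
  fixes p :: "real^'d::finite \<Rightarrow> real"
  assumes "\<And>i. integrable lborel (\<lambda>x. x $ i * p x)"
  shows "integrable lborel (\<lambda>x. p x *\<^sub>R x)"
proof -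
  have "integrable lborel (\<lambda>x. \<Sum>i\<in>UNIV. (x $ i * p x) *\<^sub>R axis i (1::real))"
    using assms by (intro Bochner_Integration.integrable_sum integrable_scaleR_left)
  moreover have "(\<Sum>i\<in>UNIV. (x $ i * p x) *\<^sub>R axis i (1::real)) = p x *\<^sub>R x" for x :: "real^'d"
    by (simp add: vec_eq_iff axis_def if_distrib cong: if_cong)
  ultimately show ?thesis by simp
qed

lemma integrable_bounded_scaleR:
  fixes g :: "'a \<Rightarrow> 'b::{banach, second_countable_topology}"
  assumes "e \<in> borel_measurable M" "\<And>z. \<bar>e z\<bar> \<le> (B :: real)" "integrable M g"
  shows "integrable M (\<lambda>z. e z *\<^sub>R g z)"
proof (rule Bochner_Integration.integrable_bound)
  show "integrable M (\<lambda>z. B *\<^sub>R g z)" using assms(3) by simp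
  have "\<bar>e z\<bar> * norm (g z) \<le> \<bar>B\<bar> * norm (g z)" for z
    using assms(2)[of z] by (intro mult_right_mono) auto
  then show "AE z in M. norm (e z *\<^sub>R g z) \<le> norm (B *\<^sub>R g z)" by simp
qed (use assms in measurable)

section \<open>Gaussian noise and the size of one interaction\<close>

text \<open>Lebesgue measure on \<open>real^'d\<close> is the image of a product of one-dimensional Lebesgue measures indexed
  by the standard basis, so integrals of products of one-variable functions factorise.\<close>

lemma has_bochner_integral_lborel_prod_vec:
  fixes h :: "'d::finite \<Rightarrow> real \<Rightarrow> real"
  assumes h: "\<And>i. integrable lborel (h i)"
  shows "has_bochner_integral lborel (\<lambda>x::real^'d. \<Prod>i\<in>UNIV. h i (x $ i))
    (\<Prod>i\<in>UNIV. \<integral>s. h i s \<partial>lborel)"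
proof -
  interpret product_sigma_finite "\<lambda>_::real^'d. lborel :: real measure" ..
  have [measurable]: "h i \<in> borel_measurable borel" for i using h[of i] by auto
  have inj: "inj (\<lambda>i::'d. axis i (1::real) :: real^'d)" by (auto simp: inj_def axis_eq_axis)
  have B: "(Basis :: (real^'d) set) = range (\<lambda>i. axis i 1)" by (auto simp: Basis_vec_def)
  define H where "H b = h (inv (\<lambda>i::'d. axis i (1::real) :: real^'d) b)" for b
  have H: "H (axis i 1) = h i" for i by (simp add: H_def inv_f_f[OF inj])
  have Hi: "integrable lborel (H b)" for b using h by (simp add: H_def)
  let ?P = "\<Pi>\<^sub>M b\<in>(Basis :: (real^'d) set). (lborel :: real measure)"
  have comp: "(\<Sum>b\<in>Basis. y b *\<^sub>R b) $ i = y (axis i 1)" for y :: "real^'d \<Rightarrow> real" and i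
    using inj by (simp add: B sum.reindex axis_def if_distrib cong: if_cong)
  have re: "(\<Prod>b\<in>Basis. k b) = (\<Prod>i\<in>UNIV. k (axis i 1))" for k :: "real^'d \<Rightarrow> real"
    using inj by (simp add: B prod.reindex)
  have "has_bochner_integral ?P (\<lambda>y. \<Prod>b\<in>Basis. H b (y b)) (\<Prod>b\<in>Basis. \<integral>s. H b s \<partial>lborel)"
    using product_integrable_prod[OF finite_Basis Hi] product_integral_prod[OF finite_Basis Hi]
    by (simp add: has_bochner_integral_iff)
  then have "has_bochner_integral ?P (\<lambda>y. \<Prod>i\<in>UNIV. h i ((\<Sum>b\<in>Basis. y b *\<^sub>R b) $ i))
    (\<Prod>i\<in>UNIV. \<integral>s. h i s \<partial>lborel)"
    unfolding comp by (simp add: re H)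
  then show ?thesis
    by (subst lborel_eq, intro has_bochner_integral_distr) measurable
qed

text \<open>The Gaussian density is a product as well, hence independence of the coordinates in the form in
  which it gives the low moments below.\<close>

lemma std_gaussian_prod_moment:
  assumes h: "\<And>i. integrable lborel (\<lambda>s. std_normal_density s * h i s)"
  shows "has_bochner_integral std_gaussian (\<lambda>\<xi>::real^'d::finite. \<Prod>i\<in>UNIV. h i (\<xi> $ i))
    (\<Prod>i\<in>UNIV. \<integral>s. std_normal_density s * h i s \<partial>lborel)"
proof -
  have hm: "(\<lambda>s. h i s) \<in> borel_measurable borel" for i
  proof -
    have "(\<lambda>s. (std_normal_density s * h i s) / std_normal_density s) \<in> borel_measurable borel"
      using h[of i] by (intro borel_measurable_divide) auto
    moreover have "std_normal_density s \<noteq> 0" for s by (simp add: std_normal_density_def)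
    ultimately show ?thesis by simp
  qed
  note [measurable] = hm
  have "has_bochner_integral lborel
     (\<lambda>\<xi>::real^'d. (\<Prod>i\<in>UNIV. std_normal_density (\<xi> $ i)) *\<^sub>R (\<Prod>i\<in>UNIV. h i (\<xi> $ i)))
     (\<Prod>i\<in>UNIV. \<integral>s. std_normal_density s * h i s \<partial>lborel)"
    using has_bochner_integral_lborel_prod_vec[OF h] by (simp add: prod.distrib)
  then show ?thesis unfolding std_gaussian_def
    by (intro has_bochner_integral_density) (auto intro!: prod_nonneg)
qed

lemma sets_std_gaussian [simp, measurable_cong]: "sets std_gaussian = sets borel"
  by (simp add: std_gaussian_def)

lemma std_gaussian_moments:
  shows prob_space_std_gaussian: "prob_space (std_gaussian :: (real^'d::finite) measure)"
    and std_gaussian_mean: "has_bochner_integral std_gaussian (\<lambda>\<xi>::real^'d. \<xi> $ i) 0"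
    and std_gaussian_cov: "has_bochner_integral std_gaussian (\<lambda>\<xi>::real^'d. \<xi> $ i * \<xi> $ j)
          (if i = j then 1 else 0)"
proof -
  let ?n = std_normal_density
  have m0: "has_bochner_integral lborel ?n 1"
    using std_normal_moment_even[of 0] by simp
  have m1: "has_bochner_integral lborel (\<lambda>s. ?n s * s) 0"
    using std_normal_moment_odd[of 0] by simp
  have m2: "has_bochner_integral lborel (\<lambda>s. ?n s * s\<^sup>2) 1"
    using std_normal_moment_even[of 1] by simp
  note I = m0[THEN has_bochner_integral_integral_eq] m1[THEN has_bochner_integral_integral_eq]
    m2[THEN has_bochner_integral_integral_eq] m0[THEN integrable.intros]
    m1[THEN integrable.intros] m2[THEN integrable.intros]
  have "has_bochner_integral std_gaussian (\<lambda>\<xi>::real^'d. 1) (1::real)"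
    using std_gaussian_prod_moment[where 'd='d, of "\<lambda>i s. 1"] I by simp
  then have "integral\<^sup>L (std_gaussian :: (real^'d) measure) (\<lambda>_. 1 :: real) = 1"
    by (simp add: has_bochner_integral_iff)
  then have "measure (std_gaussian :: (real^'d) measure) (space std_gaussian) = 1" by simp
  then have "emeasure (std_gaussian :: (real^'d) measure) (space std_gaussian) = 1"
    by (metis emeasure_eq_ennreal_measure ennreal_1 measure_zero_top zero_neq_one)
  then show "prob_space (std_gaussian :: (real^'d) measure)" by (rule prob_spaceI)
  show "has_bochner_integral std_gaussian (\<lambda>\<xi>::real^'d. \<xi> $ i) 0"
  proof -
    have int: "integrable lborel (\<lambda>s. ?n s * (if k = i then s else 1))" for k
      using I by (cases "k = i") simp_all
    have e: "(\<Prod>k\<in>UNIV. if k = i then \<xi> $ k else 1) = \<xi> $ i" for \<xi> :: "real^'d"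
      by (simp add: prod.delta)
    have z: "(\<Prod>k\<in>UNIV. \<integral>s. ?n s * (if k = i then s else 1) \<partial>lborel) = 0"
      by (intro prod_zero bexI[of _ i]) (auto simp: I)
    show ?thesis using std_gaussian_prod_moment[where h = "\<lambda>k s. if k = i then s else 1", OF int, unfolded e z] .
  qed
  show "has_bochner_integral std_gaussian (\<lambda>\<xi>::real^'d. \<xi> $ i * \<xi> $ j) (if i = j then 1 else 0)"
  proof (cases "i = j")
    case True
    have int: "integrable lborel (\<lambda>s. ?n s * (if k = i then s\<^sup>2 else 1))" for k
      using I by (cases "k = i") simp_all
    have e: "(\<Prod>k\<in>UNIV. if k = i then (\<xi> $ k)\<^sup>2 else 1) = (\<xi> $ i)\<^sup>2" for \<xi> :: "real^'d"
      by (simp add: prod.delta)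
    have z: "(\<Prod>k\<in>UNIV. \<integral>s. ?n s * (if k = i then s\<^sup>2 else 1) \<partial>lborel) = 1"
    proof (intro prod.neutral ballI)
      fix k
      show "(\<integral>s. ?n s * (if k = i then s\<^sup>2 else 1) \<partial>lborel) = 1"
        by (cases "k = i") (simp_all add: I)
    qed
    show ?thesis using std_gaussian_prod_moment[where h = "\<lambda>k s. if k = i then s\<^sup>2 else 1", OF int, unfolded e z] True
      by (simp add: power2_eq_square)
  next
    case False
    have int: "integrable lborel (\<lambda>s. ?n s * ((if k = i then s else 1) * (if k = j then s else 1)))" for k
      using I False by (cases "k = i"; cases "k = j") simp_all
    have e: "(\<Prod>k\<in>UNIV. (if k = i then \<xi> $ k else 1) * (if k = j then \<xi> $ k else 1)) = \<xi> $ i * \<xi> $ j"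
      for \<xi> :: "real^'d"
      by (simp add: prod.delta prod.distrib)
    have z: "(\<Prod>k\<in>UNIV. \<integral>s. ?n s * ((if k = i then s else 1) * (if k = j then s else 1)) \<partial>lborel) = 0"
      using False by (intro prod_zero bexI[of _ i]) (auto simp: I)
    show ?thesis using std_gaussian_prod_moment[where h = "\<lambda>k s. (if k = i then s else 1) * (if k = j then s else 1)", OF int, unfolded e z] False by simp
  qed
qed

lemma std_gaussian_inner: "has_bochner_integral std_gaussian (\<lambda>\<xi>::real^'d::finite. u \<bullet> \<xi>) 0"
proof -
  have "has_bochner_integral std_gaussian (\<lambda>\<xi>::real^'d. \<Sum>i\<in>UNIV. u $ i * \<xi> $ i) (\<Sum>i\<in>UNIV. u $ i * 0)"
    by (intro has_bochner_integral_sum has_bochner_integral_mult_right std_gaussian_mean)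
  then show ?thesis by (simp add: inner_vec_def)
qed

lemma std_gaussian_norm_matrix:
  fixes A :: "real^'d^'e"
  shows "has_bochner_integral std_gaussian (\<lambda>\<xi>. (norm (A *v \<xi>))\<^sup>2) (\<Sum>i\<in>UNIV. \<Sum>j\<in>UNIV. (A $ i $ j)\<^sup>2)"
proof -
  have "has_bochner_integral std_gaussian
      (\<lambda>\<xi>. \<Sum>i\<in>UNIV. \<Sum>j\<in>UNIV. \<Sum>k\<in>UNIV. (A $ i $ j * A $ i $ k) * (\<xi> $ j * \<xi> $ k))
      (\<Sum>i\<in>UNIV. \<Sum>j\<in>UNIV. \<Sum>k\<in>UNIV. (A $ i $ j * A $ i $ k) * (if j = k then 1 else 0))"
    by (intro has_bochner_integral_sum has_bochner_integral_mult_right std_gaussian_cov)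
  moreover have "(\<Sum>i\<in>UNIV. \<Sum>j\<in>UNIV. \<Sum>k\<in>UNIV. (A $ i $ j * A $ i $ k) * (\<xi> $ j * \<xi> $ k))
      = (norm (A *v \<xi>))\<^sup>2" for \<xi>
    unfolding power2_norm_eq_inner
    by (simp add: inner_vec_def matrix_vector_mult_def sum_product algebra_simps)
  moreover have "(\<Sum>k\<in>UNIV. (A $ i $ j * A $ i $ k) * (if j = k then 1 else 0)) = (A $ i $ j)\<^sup>2" for i j
    by (simp add: if_distrib power2_eq_square cong: if_cong)
  ultimately show ?thesis by simp
qed

text \<open>The constant \<open>\<kappa>\<close> is exactly what makes both kinds of diffusion look alike in mean square.\<close>

lemma diffusion_frobenius_norm:
  fixes D :: "real^'d \<Rightarrow> real^'d^'d"
  assumes "(D = isotropic \<and> \<kappa> = real CARD('d)) \<or> (D = anisotropic \<and> \<kappa> = 1)"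
  shows "(\<Sum>i\<in>UNIV. \<Sum>j\<in>UNIV. (D v $ i $ j)\<^sup>2) = \<kappa> * (norm v)\<^sup>2"
  using assms
proof (elim disjE conjE)
  assume "D = isotropic" "\<kappa> = real CARD('d)"
  then show ?thesis by (simp add: isotropic_def mat_def if_distrib if_distribR cong: if_cong)
next
  assume "D = anisotropic" "\<kappa> = 1"
  then show ?thesis unfolding power2_norm_eq_inner
    by (simp add: anisotropic_def if_distrib if_distribR inner_vec_def power2_eq_square cong: if_cong)
qed

lemma std_gaussian_const: "has_bochner_integral std_gaussian (\<lambda>\<xi>::real^'d::finite. c) (c :: real)"
proof -
  interpret prob_space "std_gaussian :: (real^'d) measure" by (rule prob_space_std_gaussian)
  show ?thesis by (simp add: has_bochner_integral_iff prob_space)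
qed

lemma post_position_drift:
  "has_bochner_integral std_gaussian (\<lambda>\<xi>. u \<bullet> (post_position lam sig D xa x \<xi> - x))
     (lam * (u \<bullet> (xa - x)))"
proof -
  have "has_bochner_integral std_gaussian
     (\<lambda>\<xi>. lam * (u \<bullet> (xa - x)) + sig * ((u v* D (xa - x)) \<bullet> \<xi>)) (lam * (u \<bullet> (xa - x)) + sig * 0)"
    by (intro has_bochner_integral_add has_bochner_integral_mult_right std_gaussian_inner
          std_gaussian_const)
  then show ?thesis
    by (simp add: post_position_def inner_add_right dot_lmul_matrix)
qed

lemma post_position_square:
  fixes D :: "real^'d \<Rightarrow> real^'d^'d"
  assumes D: "(D = isotropic \<and> \<kappa> = real CARD('d)) \<or> (D = anisotropic \<and> \<kappa> = 1)"
  shows "has_bochner_integral std_gaussian (\<lambda>\<xi>. (norm (post_position lam sig D xa x \<xi> - x))\<^sup>2)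
     ((lam\<^sup>2 + \<kappa> * sig\<^sup>2) * (norm (xa - x))\<^sup>2)"
proof -
  let ?v = "xa - x"
  have "has_bochner_integral std_gaussian
     (\<lambda>\<xi>. lam\<^sup>2 * (norm ?v)\<^sup>2 + 2 * lam * sig * ((?v v* D ?v) \<bullet> \<xi>) + sig\<^sup>2 * (norm (D ?v *v \<xi>))\<^sup>2)
     (lam\<^sup>2 * (norm ?v)\<^sup>2 + 2 * lam * sig * 0 + sig\<^sup>2 * (\<Sum>i\<in>UNIV. \<Sum>j\<in>UNIV. (D ?v $ i $ j)\<^sup>2))"
    by (intro has_bochner_integral_add has_bochner_integral_mult_right std_gaussian_inner
          std_gaussian_norm_matrix std_gaussian_const)
  moreover have sq: "(norm (post_position lam sig D xa x \<xi> - x))\<^sup>2 = lam\<^sup>2 * (norm ?v)\<^sup>2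
      + 2 * lam * sig * ((?v v* D ?v) \<bullet> \<xi>) + sig\<^sup>2 * (norm (D ?v *v \<xi>))\<^sup>2" for \<xi>
  proof -
    have "post_position lam sig D xa x \<xi> - x = lam *\<^sub>R ?v + sig *\<^sub>R (D ?v *v \<xi>)"
      by (simp add: post_position_def)
    then show ?thesis unfolding power2_norm_eq_inner dot_lmul_matrix
      by (simp add: inner_add_left inner_add_right inner_commute[of "D ?v *v \<xi>" ?v]
            power2_eq_square distrib_left)
  qed
  moreover have "lam\<^sup>2 * (norm ?v)\<^sup>2 + 2 * lam * sig * 0 + sig\<^sup>2 * (\<Sum>i\<in>UNIV. \<Sum>j\<in>UNIV. (D ?v $ i $ j)\<^sup>2)
      = (lam\<^sup>2 + \<kappa> * sig\<^sup>2) * (norm ?v)\<^sup>2"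
    unfolding diffusion_frobenius_norm[OF D] by (simp add: algebra_simps)
  ultimately show ?thesis by (simp only: sq)
qed

section \<open>Regularity of the expected cost\<close>

text \<open>Total differentiability makes the vector of partial derivatives represent the derivative.\<close>

lemma has_derivative_grad:
  fixes h :: "real^'d::finite \<Rightarrow> real"
  assumes "h differentiable (at x)"
  shows "(h has_derivative (\<lambda>u. grad h x \<bullet> u)) (at x)"
proof -
  define h' where "h' = frechet_derivative h (at x)"
  have d: "(h has_derivative h') (at x)"
    using assms unfolding h'_def by (simp add: frechet_derivative_works)
  interpret h': bounded_linear h' using d by (rule has_derivative_bounded_linear)
  have "h' u = grad h x \<bullet> u" for u
  proof -
    have "h' u = h' (\<Sum>i\<in>UNIV. u $ i *\<^sub>R axis i 1)"
      by (simp add: basis_expansion flip: scalar_mult_eq_scaleR)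
    then show ?thesis
      by (simp add: h'.sum h'.scaleR grad_def partial_deriv_def inner_vec_def h'_def[symmetric] mult.commute)
  qed
  then have "h' = (\<lambda>u. grad h x \<bullet> u)" by (rule ext)
  then show ?thesis using d by simp
qed

lemma lipschitz_of_grad_bound:
  fixes h :: "real^'d::finite \<Rightarrow> real"
  assumes "\<And>x. h differentiable (at x)" "\<And>x. norm (grad h x) \<le> L"
  shows "\<bar>h x - h y\<bar> \<le> L * norm (x - y)"
proof -
  have "norm (h x - h y) \<le> L * norm (x - y)"
  proof (rule differentiable_bound[where S = UNIV and f' = "\<lambda>x u. grad h x \<bullet> u"])
    show "onorm (\<lambda>u. grad h z \<bullet> u) \<le> L" for z
    proof (rule onorm_le)
      fix u
      have "norm (grad h z \<bullet> u) \<le> norm (grad h z) * norm u"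
        using Cauchy_Schwarz_ineq2[of "grad h z" u] by simp
      also have "\<dots> \<le> L * norm u" by (intro mult_right_mono assms) auto
      finally show "norm (grad h z \<bullet> u) \<le> L * norm u" .
    qed
  qed (auto intro!: has_derivative_grad assms)
  then show ?thesis by simp
qed

text \<open>Taylor's inequality. The Hessian bound makes the gradient \<open>K\<close>-Lipschitz, so along the segment the
  excess of \<open>h\<close> over its quadratic model has a nonpositive derivative.\<close>

lemma quadratic_upper_bound_of_hessian_bound:
  fixes h :: "real^'d::finite \<Rightarrow> real"
  assumes C2: "C_times 2 h" and K: "\<And>x. onorm ((*v) (hessian h x)) \<le> K"
  shows "h (x + u) \<le> h x + grad h x \<bullet> u + K / 2 * (norm u)\<^sup>2"
proof -
  have d: "h differentiable (at x)" and dd: "partial_deriv i h differentiable (at x)" for x i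
    using C2 by (auto simp: numeral_2_eq_2)
  have "grad h differentiable (at x)" for x
  proof -
    have "(partial_deriv i h has_derivative frechet_derivative (partial_deriv i h) (at x)) (at x)" for i
      using dd by (simp add: frechet_derivative_works)
    then have "((\<lambda>y. grad h y) has_derivative (\<lambda>u. \<chi> i. frechet_derivative (partial_deriv i h) (at x) u)) (at x)"
      unfolding grad_def
      by (subst has_derivative_componentwise_within) (auto simp: Basis_vec_def inner_axis)
    then show ?thesis by (auto simp: differentiable_def)
  qed
  then have gd: "(grad h has_derivative (*v) (hessian h x)) (at x)" for x
    unfolding hessian_def by (simp add: jacobian_works)
  have gl: "norm (grad h x - grad h y) \<le> K * norm (x - y)" for x y
    by (rule differentiable_bound[where S = UNIV]) (auto intro: gd K)
  define \<phi> where "\<phi> s = h (x + s *\<^sub>R u) - s * (grad h x \<bullet> u) - K / 2 * s\<^sup>2 * (norm u)\<^sup>2" for s :: real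
  have \<phi>': "(\<phi> has_real_derivative ((grad h (x + s *\<^sub>R u) - grad h x) \<bullet> u - K * s * (norm u)\<^sup>2)) (at s)" for s
  proof -
    have "((\<lambda>s. h (x + s *\<^sub>R u)) has_derivative (\<lambda>r. grad h (x + s *\<^sub>R u) \<bullet> (r *\<^sub>R u))) (at s)"
      by (rule has_derivative_compose[where f = "\<lambda>s. x + s *\<^sub>R u" and g = h])
         (auto intro!: derivative_eq_intros has_derivative_grad d)
    then have "((\<lambda>s. h (x + s *\<^sub>R u)) has_real_derivative (grad h (x + s *\<^sub>R u) \<bullet> u)) (at s)"
      by (intro has_derivative_imp_has_field_derivative) (auto simp: mult.commute)
    then show ?thesis unfolding \<phi>_def
      by (auto intro!: derivative_eq_intros simp: inner_diff_left)
  qed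
  have "\<phi> 1 \<le> \<phi> 0"
  proof (rule DERIV_nonpos_imp_nonincreasing[of 0 1 \<phi>])
    fix s :: real assume s: "0 \<le> s" "s \<le> 1"
    have "(grad h (x + s *\<^sub>R u) - grad h x) \<bullet> u \<le> norm (grad h (x + s *\<^sub>R u) - grad h x) * norm u"
      by (rule norm_cauchy_schwarz)
    also have "\<dots> \<le> (K * norm ((x + s *\<^sub>R u) - x)) * norm u"
      by (intro mult_right_mono gl) auto
    also have "\<dots> = K * s * (norm u)\<^sup>2" using s by (simp add: power2_eq_square)
    finally show "\<exists>y. (\<phi> has_real_derivative y) (at s) \<and> y \<le> 0" using \<phi>'[of s] by auto
  qed simp
  then show ?thesis by (simp add: \<phi>_def)
qed

text \<open>Both bounds hold for each realisation of the random vector and are integrated. The slope \<open>G\<close> of the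
  quadratic bound is the expectation of the pointwise gradient.\<close>

lemma expected_cost_regularity:
  fixes F :: "real^'d::finite \<Rightarrow> 'b \<Rightarrow> real"
  assumes Y: "\<And>w. w \<in> space P \<Longrightarrow> Y w \<in> E"
    and F_int: "\<And>x. integrable P (\<lambda>w. F x (Y w))"
    and f_def: "f = (\<lambda>x. \<integral>w. F x (Y w) \<partial>P)"
    and C2: "\<And>y. y \<in> E \<Longrightarrow> C_times 2 (\<lambda>x. F x y)"
    and g: "\<And>x y. y \<in> E \<Longrightarrow> norm (grad (\<lambda>x. F x y) x) \<le> c1 y"
    and h: "\<And>x y. y \<in> E \<Longrightarrow> onorm ((*v) (hessian (\<lambda>x. F x y) x)) \<le> c2 y"
    and c: "integrable P (\<lambda>w. c1 (Y w))" "integrable P (\<lambda>w. c2 (Y w))"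
    and L: "L = (\<integral>w. c1 (Y w) \<partial>P)" and K: "K = (\<integral>w. c2 (Y w) \<partial>P)"
  shows expected_cost_lipschitz: "\<bar>f x - f y\<bar> \<le> L * norm (x - y)"
    and expected_cost_quadratic_upper_bound:
      "\<exists>G. norm G \<le> L \<and> (\<forall>u. f (x + u) \<le> f x + G \<bullet> u + K / 2 * (norm u)\<^sup>2)"
proof -
  have diff: "(\<lambda>x. F x y) differentiable (at x)" if "y \<in> E" for x y
    using C2[OF that] by (simp add: numeral_2_eq_2)
  have "\<bar>f x - f y\<bar> = \<bar>\<integral>w. F x (Y w) - F y (Y w) \<partial>P\<bar>"
    using F_int by (simp add: f_def)
  also have "\<dots> \<le> (\<integral>w. \<bar>F x (Y w) - F y (Y w)\<bar> \<partial>P)" by (rule integral_abs_bound)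
  also have "\<dots> \<le> (\<integral>w. c1 (Y w) * norm (x - y) \<partial>P)"
    using F_int c Y by (intro integral_mono) (auto intro!: lipschitz_of_grad_bound diff g)
  finally show "\<bar>f x - f y\<bar> \<le> L * norm (x - y)" by (simp add: L)

  define \<Gamma> where "\<Gamma> w = grad (\<lambda>x. F x (Y w)) x" for w
  \<comment> \<open>The gradient is measurable in the random outcome as a limit of difference quotients.\<close>
  have lim: "(\<lambda>n. (F (x + (1 / Suc n) *\<^sub>R u) (Y w) - F x (Y w)) * Suc n) \<longlonglongrightarrow> \<Gamma> w \<bullet> u"
    if w: "w \<in> space P" for w u
  proof -
    let ?h = "\<lambda>x. F x (Y w)"
    have "((\<lambda>s. ?h (x + s *\<^sub>R u)) has_derivative (\<lambda>r. \<Gamma> w \<bullet> (r *\<^sub>R u))) (at 0)"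
      using has_derivative_grad[OF diff[OF Y[OF w]], of x]
      by (intro has_derivative_compose[where f = "\<lambda>s. x + s *\<^sub>R u" and g = ?h])
         (auto intro!: derivative_eq_intros simp: \<Gamma>_def)
    then have "((\<lambda>s. ?h (x + s *\<^sub>R u)) has_real_derivative (\<Gamma> w \<bullet> u)) (at 0)"
      by (intro has_derivative_imp_has_field_derivative) (auto simp: mult.commute)
    then have "((\<lambda>s. (?h (x + s *\<^sub>R u) - ?h x) / s) \<longlongrightarrow> \<Gamma> w \<bullet> u) (at 0)"
      by (simp add: DERIV_def)
    moreover have "filterlim (\<lambda>n. 1 / real (Suc n)) (at 0) sequentially"
      unfolding filterlim_at using LIMSEQ_Suc[OF lim_1_over_n] by auto
    ultimately have "(\<lambda>n. (?h (x + (1 / real (Suc n)) *\<^sub>R u) - ?h x) / (1 / real (Suc n))) \<longlonglongrightarrow> \<Gamma> w \<bullet> u"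
      by (rule filterlim_compose)
    then show ?thesis by simp
  qed
  have "(\<lambda>w. \<Gamma> w \<bullet> u) \<in> borel_measurable P" for u
    by (rule borel_measurable_LIMSEQ_real[OF lim]) (use F_int in auto)
  then have [measurable]: "\<Gamma> \<in> borel_measurable P"
    by (subst borel_measurable_euclidean_space) auto
  have \<Gamma>_le: "norm (\<Gamma> w) \<le> c1 (Y w)" if "w \<in> space P" for w
    using g[OF Y[OF that]] by (simp add: \<Gamma>_def)
  have \<Gamma>: "integrable P \<Gamma>"
    by (rule Bochner_Integration.integrable_bound[OF c(1)])
       (use \<Gamma>_le in \<open>auto intro: order_trans[OF _ abs_ge_self]\<close>)
  have "norm (\<integral>w. \<Gamma> w \<partial>P) \<le> L" unfolding L
    using \<Gamma> c \<Gamma>_le by (intro order_trans[OF integral_norm_bound integral_mono]) auto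
  moreover have "f (x + u) \<le> f x + (\<integral>w. \<Gamma> w \<partial>P) \<bullet> u + K / 2 * (norm u)\<^sup>2" for u
  proof -
    have "f (x + u) \<le> (\<integral>w. F x (Y w) + \<Gamma> w \<bullet> u + c2 (Y w) / 2 * (norm u)\<^sup>2 \<partial>P)"
      unfolding f_def
    proof (intro integral_mono)
      fix w assume w: "w \<in> space P"
      show "F (x + u) (Y w) \<le> F x (Y w) + \<Gamma> w \<bullet> u + c2 (Y w) / 2 * (norm u)\<^sup>2"
        unfolding \<Gamma>_def using Y[OF w] by (intro quadratic_upper_bound_of_hessian_bound C2 h)
    qed (use F_int c \<Gamma> in auto)
    also have "\<dots> = f x + (\<integral>w. \<Gamma> w \<partial>P) \<bullet> u + K / 2 * (norm u)\<^sup>2"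
      unfolding f_def K using F_int c \<Gamma> by simp
    finally show ?thesis .
  qed
  ultimately show "\<exists>G. norm G \<le> L \<and> (\<forall>u. f (x + u) \<le> f x + G \<bullet> u + K / 2 * (norm u)\<^sup>2)"
    by blast
qed

section \<open>The collision operator on coordinates, squared norm and Gibbs weight\<close>

lemma collision_coordinate:
  "collision_integrand lam sig \<alpha> D F \<theta> p (\<lambda>x. x $ i)
    = (\<lambda>(x, ys). lam * ((consensus \<alpha> F p ys - x) $ i * p x * \<theta> ys))"
proof -
  have "(\<integral>\<xi>. post_position lam sig D xa x \<xi> $ i - x $ i \<partial>std_gaussian) = lam * (xa - x) $ i" for xa x
    using post_position_drift[of "axis i 1" lam sig D xa x]
    by (simp add: has_bochner_integral_iff inner_axis')
  then show ?thesis by (simp add: collision_integrand_def fun_eq_iff)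
qed

text \<open>From \<open>|x'|\<^sup>2 - |x|\<^sup>2 = 2 x \<bullet> (x' - x) + |x' - x|\<^sup>2\<close> and the two moments of the jump.\<close>

lemma collision_norm_square:
  fixes D :: "real^'d \<Rightarrow> real^'d^'d"
  assumes D: "(D = isotropic \<and> \<kappa> = real CARD('d)) \<or> (D = anisotropic \<and> \<kappa> = 1)"
  shows "collision_integrand lam sig \<alpha> D F \<theta> p (\<lambda>x. (norm x)\<^sup>2)
    = (\<lambda>(x, ys). 2 * lam * ((x \<bullet> (consensus \<alpha> F p ys - x)) * p x * \<theta> ys)
        + (lam\<^sup>2 + \<kappa> * sig\<^sup>2) * ((norm (consensus \<alpha> F p ys - x))\<^sup>2 * p x * \<theta> ys))"
proof -
  have mean: "(\<integral>\<xi>. (norm (post_position lam sig D xa x \<xi>))\<^sup>2 - (norm x)\<^sup>2 \<partial>std_gaussian)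
      = 2 * lam * (x \<bullet> (xa - x)) + (lam\<^sup>2 + \<kappa> * sig\<^sup>2) * (norm (xa - x))\<^sup>2" for xa x
  proof -
    have "has_bochner_integral std_gaussian
       (\<lambda>\<xi>. 2 * (x \<bullet> (post_position lam sig D xa x \<xi> - x)) + (norm (post_position lam sig D xa x \<xi> - x))\<^sup>2)
       (2 * (lam * (x \<bullet> (xa - x))) + (lam\<^sup>2 + \<kappa> * sig\<^sup>2) * (norm (xa - x))\<^sup>2)"
      by (intro has_bochner_integral_add has_bochner_integral_mult_right post_position_drift
            post_position_square[OF D])
    moreover have "2 * (x \<bullet> (z - x)) + (norm (z - x))\<^sup>2 = (norm z)\<^sup>2 - (norm x)\<^sup>2" for z
      by (simp add: power2_norm_eq_inner inner_diff inner_commute)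
    ultimately show ?thesis by (simp add: has_bochner_integral_iff)
  qed
  show ?thesis
    unfolding collision_integrand_def mean by (simp add: fun_eq_iff distrib_right mult.assoc)
qed

text \<open>A weight \<open>exp (- \<alpha> f)\<close> can decrease in one jump only as far as \<open>f\<close> can increase; since \<open>exp s \<ge> 1 + s\<close>,
  the loss is linear in an upper bound \<open>q\<close> on that increase.\<close>

lemma exp_neg_step_lower_bound:
  fixes a b q \<alpha> :: real
  assumes "0 < \<alpha>" "b \<le> a + q"
  shows "exp (- \<alpha> * a) * (1 - \<alpha> * q) \<le> exp (- \<alpha> * b)"
proof -
  have "exp (- \<alpha> * a) * (1 - \<alpha> * q) \<le> exp (- \<alpha> * a) * exp (- \<alpha> * q)"
    using exp_ge_add_one_self[of "- \<alpha> * q"] by (intro mult_left_mono) auto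
  also have "\<dots> = exp (- \<alpha> * (a + q))" by (simp add: exp_add[symmetric] algebra_simps)
  also have "\<dots> \<le> exp (- \<alpha> * b)" using assms by simp
  finally show ?thesis .
qed

text \<open>Apply the previous bound to \<open>q = G \<bullet> u + K |u|\<^sup>2 / 2\<close> with \<open>u\<close> the jump, and average over the noise: only
  the mean and the mean square of the jump survive. Finally the weight at \<open>x\<close> is bounded by
  \<open>exp (- \<alpha> flo)\<close>.\<close>

lemma collision_exp_lower_bound:
  fixes D :: "real^'d \<Rightarrow> real^'d^'d"
  assumes D: "(D = isotropic \<and> \<kappa> = real CARD('d)) \<or> (D = anisotropic \<and> \<kappa> = 1)"
    and pos: "0 < lam" "0 < \<alpha>" "0 \<le> K" "0 \<le> p x" "0 \<le> \<theta> ys"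
    and f_cont: "continuous_on UNIV f" and f_ge: "\<And>x. flo \<le> f x"
    and G: "norm G \<le> L" "\<And>u. f (x + u) \<le> f x + G \<bullet> u + K / 2 * (norm u)\<^sup>2"
  shows "- (\<alpha> * exp (- \<alpha> * flo)) * (lam * L * norm (consensus \<alpha> F p ys - x)
      + (lam\<^sup>2 + \<kappa> * sig\<^sup>2) * K / 2 * (norm (consensus \<alpha> F p ys - x))\<^sup>2) * p x * \<theta> ys
    \<le> collision_integrand lam sig \<alpha> D F \<theta> p (\<lambda>x. exp (- \<alpha> * f x)) (x, ys)"
proof -
  interpret G: prob_space "std_gaussian :: (real^'d) measure" by (rule prob_space_std_gaussian)
  define xa where "xa = consensus \<alpha> F p ys"
  let ?pp = "post_position lam sig D xa x" and ?\<omega> = "\<lambda>x. exp (- \<alpha> * f x)" and ?r = "norm (xa - x)"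
  let ?Q = "lam * L * ?r + (lam\<^sup>2 + \<kappa> * sig\<^sup>2) * K / 2 * ?r\<^sup>2"
  have \<kappa>: "0 \<le> \<kappa>" using D by auto
  have \<omega>_le: "?\<omega> z \<le> exp (- \<alpha> * flo)" for z using f_ge[of z] pos by simp
  have "continuous_on UNIV (\<lambda>\<xi>. ?\<omega> (?pp \<xi>))"
    unfolding post_position_def
    by (intro continuous_intros continuous_on_compose2[OF f_cont] matrix_vector_mult_linear_continuous_on)
       auto
  then have "(\<lambda>\<xi>. ?\<omega> (?pp \<xi>)) \<in> borel_measurable borel" by (rule borel_measurable_continuous_onI)
  then have \<omega>_int: "integrable std_gaussian (\<lambda>\<xi>. ?\<omega> (?pp \<xi>))"
    using \<omega>_le by (intro G.integrable_const_bound[where B = "exp (- \<alpha> * flo)"])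
      (auto cong: measurable_cong_sets)
  have step: "has_bochner_integral std_gaussian
      (\<lambda>\<xi>. - \<alpha> * ?\<omega> x * (G \<bullet> (?pp \<xi> - x) + K / 2 * (norm (?pp \<xi> - x))\<^sup>2))
      (- \<alpha> * ?\<omega> x * (lam * (G \<bullet> (xa - x)) + K / 2 * ((lam\<^sup>2 + \<kappa> * sig\<^sup>2) * ?r\<^sup>2)))"
    by (intro has_bochner_integral_mult_right has_bochner_integral_add post_position_drift
          post_position_square D)
  have Q: "lam * (G \<bullet> (xa - x)) + K / 2 * ((lam\<^sup>2 + \<kappa> * sig\<^sup>2) * ?r\<^sup>2) \<le> ?Q"
  proof -
    have "G \<bullet> (xa - x) \<le> L * ?r"
      using norm_cauchy_schwarz[of G "xa - x"] G(1) by (meson mult_right_mono norm_ge_zero order_trans)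
    then have "lam * (G \<bullet> (xa - x)) \<le> lam * L * ?r" using pos by (simp add: mult.assoc)
    moreover have "K / 2 * ((lam\<^sup>2 + \<kappa> * sig\<^sup>2) * ?r\<^sup>2) = (lam\<^sup>2 + \<kappa> * sig\<^sup>2) * K / 2 * ?r\<^sup>2"
      by simp
    ultimately show ?thesis by linarith
  qed
  have "0 \<le> L" using G(1) norm_ge_zero order_trans by blast
  then have "0 \<le> ?Q" using pos \<kappa> by simp
  then have "(\<alpha> * ?\<omega> x) * ?Q \<le> (\<alpha> * exp (- \<alpha> * flo)) * ?Q"
    using \<omega>_le[of x] pos by (intro mult_right_mono mult_left_mono) auto
  moreover have "(\<alpha> * ?\<omega> x) * (lam * (G \<bullet> (xa - x)) + K / 2 * ((lam\<^sup>2 + \<kappa> * sig\<^sup>2) * ?r\<^sup>2))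
      \<le> (\<alpha> * ?\<omega> x) * ?Q"
    using pos by (intro mult_left_mono Q) auto
  ultimately have "- (\<alpha> * exp (- \<alpha> * flo)) * ?Q
      \<le> - \<alpha> * ?\<omega> x * (lam * (G \<bullet> (xa - x)) + K / 2 * ((lam\<^sup>2 + \<kappa> * sig\<^sup>2) * ?r\<^sup>2))"
    by simp
  also have "\<dots> \<le> (\<integral>\<xi>. ?\<omega> (?pp \<xi>) - ?\<omega> x \<partial>std_gaussian)"
  proof (rule has_bochner_integral_le[OF step])
    show "has_bochner_integral std_gaussian (\<lambda>\<xi>. ?\<omega> (?pp \<xi>) - ?\<omega> x)
        (\<integral>\<xi>. ?\<omega> (?pp \<xi>) - ?\<omega> x \<partial>std_gaussian)"
      using \<omega>_int by (intro has_bochner_integral_integrable) auto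
    fix \<xi> :: "real^'d"
    have "f (?pp \<xi>) \<le> f x + (G \<bullet> (?pp \<xi> - x) + K / 2 * (norm (?pp \<xi> - x))\<^sup>2)"
      using G(2)[of "?pp \<xi> - x"] by simp
    from exp_neg_step_lower_bound[OF pos(2) this]
    show "- \<alpha> * ?\<omega> x * (G \<bullet> (?pp \<xi> - x) + K / 2 * (norm (?pp \<xi> - x))\<^sup>2) \<le> ?\<omega> (?pp \<xi>) - ?\<omega> x"
      by (simp add: algebra_simps)
  qed
  finally have "- (\<alpha> * exp (- \<alpha> * flo)) * ?Q \<le> (\<integral>\<xi>. ?\<omega> (?pp \<xi>) - ?\<omega> x \<partial>std_gaussian)" .
  from mult_right_mono[OF mult_right_mono[OF this pos(4)] pos(5)] show ?thesis
    by (simp only: collision_integrand_def xa_def split_conv)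
qed

section \<open>Distance to the consensus point\<close>

text \<open>The consensus point is the barycentre \<open>c\<close> of the weight \<open>w = e p\<close>, where \<open>e\<close> is the Gibbs factor of
  the sampled cost. By the parallel axis theorem \<open>|c - x|\<^sup>2\<close> times the mass of \<open>w\<close> is at most the
  second moment of \<open>w\<close> about \<open>x\<close>; the mass is at least \<open>exp (- \<alpha> b)\<close> and \<open>e\<close> is at most
  \<open>exp (- \<alpha> a)\<close>.\<close>

lemma consensus_dist_le:
  fixes p :: "real^'d::finite \<Rightarrow> real"
  assumes p: "prob_density p"
    and coord: "\<And>i. integrable lborel (\<lambda>x. x $ i * p x)"
    and square: "integrable lborel (\<lambda>x. (norm x)\<^sup>2 * p x)"
    and \<alpha>: "0 < \<alpha>"
    and meas: "(\<lambda>x. sample_avg (F x) ys) \<in> borel_measurable borel"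
    and bnd: "\<And>x. a \<le> sample_avg (F x) ys" "\<And>x. sample_avg (F x) ys \<le> b"
  shows "(norm (consensus \<alpha> F p ys - x))\<^sup>2 \<le> exp (\<alpha> * (b - a)) * (\<integral>z. (norm (z - x))\<^sup>2 * p z \<partial>lborel)"
proof -
  note mom = integrable_position[OF coord] square
  define e where "e z = exp (- \<alpha> * sample_avg (F z) ys)" for z
  define w where "w z = e z * p z" for z
  define Z where "Z = (\<integral>z. w z \<partial>lborel)"
  define c where "c = consensus \<alpha> F p ys"
  have p': "p \<in> borel_measurable borel" "\<And>x. 0 \<le> p x" "integrable lborel p" "(\<integral>x. p x \<partial>lborel) = 1"
    using p by (auto simp: prob_density_def)
  have [measurable]: "e \<in> borel_measurable borel" "p \<in> borel_measurable borel" using meas p' by (auto simp: e_def[abs_def])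
  have e: "0 \<le> e z" "e z \<le> exp (- \<alpha> * a)" "exp (- \<alpha> * b) \<le> e z" for z
    using bnd[of z] \<alpha> by (auto simp: e_def)
  have e_abs: "\<bar>e z\<bar> \<le> exp (- \<alpha> * a)" for z using e[of z] by simp
  note bounded = integrable_bounded_scaleR[OF _ e_abs]
  have w_int: "integrable lborel w"
    using bounded[OF _ p'(3)] by (simp add: w_def[abs_def])
  have w1: "integrable lborel (\<lambda>z. w z *\<^sub>R z)"
    using bounded[OF _ mom(1)] by (simp add: w_def)
  have w2: "integrable lborel (\<lambda>z. (norm z)\<^sup>2 * w z)"
    using bounded[OF _ mom(2)] by (simp add: w_def mult.left_commute)
  have "exp (- \<alpha> * b) = (\<integral>z. exp (- \<alpha> * b) * p z \<partial>lborel)" using p' by simp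
  also have "\<dots> \<le> Z" unfolding Z_def
    using e p' w_int by (intro integral_mono) (auto simp: w_def intro: mult_right_mono)
  finally have Z: "exp (- \<alpha> * b) \<le> Z" .
  then have Z0: "0 < Z" using exp_gt_zero order_less_le_trans by blast
  have c: "(\<integral>z. w z *\<^sub>R z \<partial>lborel) = Z *\<^sub>R c"
    using Z0 by (simp add: c_def consensus_def Z_def w_def e_def)
  note about = second_moment_about[OF w_int w1 w2 c[unfolded Z_def], where a = x]
  have p_about: "integrable lborel (\<lambda>z. (norm (z - x))\<^sup>2 * p z)"
    by (rule second_moment_about(1)[OF p'(3) mom, where c = "density_mean p"])
       (simp add: p' density_mean_def)
  have "exp (- \<alpha> * b) * (norm (c - x))\<^sup>2 \<le> Z * (norm (c - x))\<^sup>2"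
    using Z by (intro mult_right_mono) auto
  also have "\<dots> \<le> (\<integral>z. (norm (z - x))\<^sup>2 * w z \<partial>lborel)"
    unfolding about(2) Z_def using e p'(2)
    by (simp add: w_def Bochner_Integration.integral_nonneg)
  also have "\<dots> \<le> (\<integral>z. exp (- \<alpha> * a) * ((norm (z - x))\<^sup>2 * p z) \<partial>lborel)"
  proof (intro integral_mono about(1) integrable_mult_right p_about)
    fix z
    have "(norm (z - x))\<^sup>2 * p z * e z \<le> (norm (z - x))\<^sup>2 * p z * exp (- \<alpha> * a)"
      using e(2) p'(2) by (intro mult_left_mono) auto
    then show "(norm (z - x))\<^sup>2 * w z \<le> exp (- \<alpha> * a) * ((norm (z - x))\<^sup>2 * p z)"
      by (simp add: w_def mult.assoc mult.commute mult.left_commute)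
  qed
  finally have "exp (- \<alpha> * b) * (norm (c - x))\<^sup>2 \<le> exp (- \<alpha> * a) * (\<integral>z. (norm (z - x))\<^sup>2 * p z \<partial>lborel)"
    by simp
  then have "exp (\<alpha> * b) * (exp (- \<alpha> * b) * (norm (c - x))\<^sup>2)
      \<le> exp (\<alpha> * b) * (exp (- \<alpha> * a) * (\<integral>z. (norm (z - x))\<^sup>2 * p z \<partial>lborel))"
    by (rule mult_left_mono) simp
  moreover have "exp (\<alpha> * b) * exp (- \<alpha> * b) = 1" "exp (\<alpha> * b) * exp (- \<alpha> * a) = exp (\<alpha> * (b - a))"
    by (simp_all add: exp_add[symmetric] algebra_simps)
  ultimately show ?thesis by (simp only: mult.assoc[symmetric] c_def mult_1_left)
qed

section \<open>Densities with finite variance\<close>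

locale square_integrable_density =
  fixes p :: "real^'d::finite \<Rightarrow> real"
  assumes p: "prob_density p"
    and coord: "\<And>i. integrable lborel (\<lambda>x. x $ i * p x)"
    and square: "integrable lborel (\<lambda>x. (norm x)\<^sup>2 * p x)"
begin

abbreviation "m \<equiv> density_mean p"
abbreviation "V \<equiv> density_V p"

lemma p_density: "p \<in> borel_measurable borel" "\<And>x. 0 \<le> p x" "integrable lborel p" "(\<integral>x. p x \<partial>lborel) = 1"
  using p by (auto simp: prob_density_def)

lemma mean_nth: "m $ i = (\<integral>x. x $ i * p x \<partial>lborel)"
proof -
  have "m \<bullet> axis i 1 = (\<integral>x. (p x *\<^sub>R x) \<bullet> axis i 1 \<partial>lborel)"
    unfolding density_mean_def by (intro integral_inner_left[symmetric] integrable_position coord)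
  then show ?thesis by (simp add: inner_axis mult.commute)
qed

lemmas second_moment = second_moment_about[OF p_density(3) integrable_position[OF coord] square, where c = m,
    unfolded p_density(4), simplified, OF density_mean_def[symmetric]]

lemma V_eq: "V = ((\<integral>x. (norm x)\<^sup>2 * p x \<partial>lborel) - (norm m)\<^sup>2) / 2"
  using second_moment(2)[of 0] by (simp add: density_V_def)

lemma second_moment_about_eq: "(\<integral>z. (norm (z - x))\<^sup>2 * p z \<partial>lborel) = 2 * V + (norm (m - x))\<^sup>2"
  using second_moment(2)[of x] by (simp add: density_V_def)

lemma V_nonneg: "0 \<le> V"
  unfolding density_V_def using p_density by (simp add: Bochner_Integration.integral_nonneg)

text \<open>A density with small variance and mean near \<open>a\<close> averages a function that is Lipschitz around \<open>a\<close>
  to little more than its value there. This transfers a lower bound on the Gibbs weight to the limit point.\<close>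

lemma integral_le_of_lipschitz_bound:
  assumes \<psi>: "integrable lborel (\<lambda>x. \<psi> x * p x)" "\<And>x. \<psi> x \<le> k + B * norm (x - a)" and B: "0 \<le> B"
  shows "(\<integral>x. \<psi> x * p x \<partial>lborel) \<le> k + B * sqrt (2 * V + (norm (m - a))\<^sup>2)"
proof -
  have [measurable]: "p \<in> borel_measurable borel" by (rule p_density)
  have int: "integrable lborel (\<lambda>x. norm (x - a) * p x)"
  proof (rule integrable_of_second_moment[OF p_density(3,2)])
    show "integrable lborel (\<lambda>x. (norm (x - a))\<^sup>2 * p x)" by (rule second_moment(1))
    show "(\<lambda>x. norm (x - a) * p x) \<in> borel_measurable lborel" by measurable
  qed
  have "(\<integral>x. \<psi> x * p x \<partial>lborel) \<le> (\<integral>x. k * p x + B * (norm (x - a) * p x) \<partial>lborel)"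
  proof (intro integral_mono \<psi>(1))
    show "integrable lborel (\<lambda>x. k * p x + B * (norm (x - a) * p x))" using int p_density by simp
    show "\<psi> x * p x \<le> k * p x + B * (norm (x - a) * p x)" for x
      using mult_right_mono[OF \<psi>(2) p_density(2)] by (simp add: distrib_right mult.assoc)
  qed
  also have "\<dots> = k + B * (\<integral>x. norm (x - a) * p x \<partial>lborel)" using int p_density by simp
  also have "\<dots> \<le> k + B * sqrt (\<integral>x. (norm (x - a))\<^sup>2 * p x \<partial>lborel)"
    using integral_le_sqrt_second_moment[OF p_density(3,2,4) int second_moment(1)] B
    by (intro add_left_mono mult_left_mono)
  finally show ?thesis by (simp add: second_moment_about_eq)
qed

end

section \<open>Averages of the displacement towards the consensus point\<close>

text \<open>One instant of the evolution: \<open>p\<close> is the density of the positions, \<open>\<theta>\<close> that of the samples, and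
  \<open>X\<close> sends a sample to its consensus point. The factor \<open>\<Gamma>\<close> stands for
  \<open>exp (\<alpha> (fhi - flo))\<close> and \<open>C\<close> for its mean \<open>C\<^sub>\<alpha>\<close>. Where \<open>\<theta>\<close> vanishes,
  the map \<open>X\<close> is arbitrary and may fail to be measurable, because the cost is measurable only relative
  to a set of samples that need not be Borel; the drift hypothesis is therefore also the source of all
  measurability, and the distance bound is restricted to samples with \<open>\<theta> y \<noteq> 0\<close>.\<close>

locale displacement = square_integrable_density p for p :: "real^'d::finite \<Rightarrow> real" +
  fixes \<theta> :: "'s::euclidean_space \<Rightarrow> real"
    and X :: "'s \<Rightarrow> real^'d" and \<Gamma> :: "'s \<Rightarrow> real" and C :: real
  assumes \<theta>: "prob_density \<theta>"
    and drift: "\<And>i. integrable (lborel \<Otimes>\<^sub>M lborel) (\<lambda>(x, y). (X y - x) $ i * p x * \<theta> y)"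
    and dist: "\<And>x y. \<theta> y \<noteq> 0 \<Longrightarrow> (norm (X y - x))\<^sup>2 \<le> \<Gamma> y * (\<integral>z. (norm (z - x))\<^sup>2 * p z \<partial>lborel)"
    and \<Gamma>: "integrable lborel (\<lambda>y. \<Gamma> y * \<theta> y)" "\<And>y. 0 \<le> \<Gamma> y"
    and C: "C = (\<integral>y. \<Gamma> y * \<theta> y \<partial>lborel)"
begin

lemma \<theta>_density: "\<theta> \<in> borel_measurable borel" "\<And>x. 0 \<le> \<theta> x" "integrable lborel \<theta>" "(\<integral>x. \<theta> x \<partial>lborel) = 1"
  using \<theta> by (auto simp: prob_density_def)

lemma C_nonneg: "0 \<le> C"
  unfolding C using \<Gamma> \<theta>_density by (simp add: Bochner_Integration.integral_nonneg)

lemma pair_times: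
  fixes a :: "real^'d \<Rightarrow> real" and b :: "'s \<Rightarrow> real"
  assumes "integrable lborel a" "integrable lborel b"
  shows "has_bochner_integral (lborel \<Otimes>\<^sub>M lborel) (\<lambda>(x, y). a x * b y)
    ((\<integral>x. a x \<partial>lborel) * (\<integral>y. b y \<partial>lborel))"
  using assms by (intro has_bochner_integral_pair_times) (auto intro: lborel.sigma_finite_measure_axioms)

text \<open>Adding the position to the integrable drift leaves \<open>p x * (X y $ i * \<theta> y)\<close>, and \<open>p\<close> has mass one, so
  integrating out \<open>x\<close> isolates \<open>X y $ i * \<theta> y\<close>.\<close>

lemma integrable_consensus: "integrable lborel (\<lambda>y. X y $ i * \<theta> y)"
proof -
  have "integrable (lborel \<Otimes>\<^sub>M lborel) (\<lambda>(x, y). (x $ i * p x) * \<theta> y)"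
    using pair_times[OF coord \<theta>_density(3)] by (simp add: has_bochner_integral_iff)
  note Bochner_Integration.integrable_add[OF drift[of i] this]
  moreover have "(\<lambda>z. (\<lambda>(x, y). (X y - x) $ i * p x * \<theta> y) z + (\<lambda>(x, y). (x $ i * p x) * \<theta> y) z)
      = (\<lambda>(x, y). p x * (X y $ i * \<theta> y))"
    by (simp add: fun_eq_iff algebra_simps)
  ultimately have "integrable (lborel \<Otimes>\<^sub>M lborel) (\<lambda>(x, y). p x * (X y $ i * \<theta> y))"
    by simp
  from lborel_pair.integrable_snd[OF this] show ?thesis by (simp add: p_density)
qed

text \<open>Where \<open>\<theta>\<close> is nonzero, \<open>X\<close> is recovered from the measurable product \<open>X \<theta>\<close> by division; where \<open>\<theta>\<close>
  vanishes, so do the functions in question.\<close>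

lemma borel_measurable_displacement:
  "(\<lambda>(x, y). (norm (X y - x))\<^sup>2 * p x * \<theta> y) \<in> borel_measurable (lborel \<Otimes>\<^sub>M lborel)"
  "(\<lambda>(x, y). norm (X y - x) * p x * \<theta> y) \<in> borel_measurable (lborel \<Otimes>\<^sub>M lborel)"
proof -
  define q where "q i y = X y $ i * \<theta> y" for i y
  have [measurable]: "q i \<in> borel_measurable borel" "p \<in> borel_measurable borel"
    "\<theta> \<in> borel_measurable borel" for i
    using integrable_consensus[of i] p_density \<theta>_density by (auto simp: q_def[abs_def])
  have [measurable]: "(\<lambda>x::real^'d. x $ i) \<in> borel_measurable borel" for i
    by (intro borel_measurable_continuous_onI continuous_intros)
  let ?S = "\<lambda>(x, y). \<Sum>i\<in>UNIV. (q i y / \<theta> y - x $ i)\<^sup>2"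
  have eq: "?S (x, y) = (norm (X y - x))\<^sup>2" if "\<theta> y \<noteq> 0" for x y
    unfolding power2_norm_eq_inner using that by (simp add: q_def inner_vec_def power2_eq_square)
  have [measurable]: "?S \<in> borel_measurable (lborel \<Otimes>\<^sub>M lborel)" by measurable
  have "(\<lambda>(x, y). (norm (X y - x))\<^sup>2 * p x * \<theta> y) = (\<lambda>(x, y). ?S (x, y) * p x * \<theta> y)"
    "(\<lambda>(x, y). norm (X y - x) * p x * \<theta> y) = (\<lambda>(x, y). sqrt (?S (x, y)) * p x * \<theta> y)"
    unfolding fun_eq_iff using eq by (auto simp del: split_conv simp: split_def)
  then show "(\<lambda>(x, y). (norm (X y - x))\<^sup>2 * p x * \<theta> y) \<in> borel_measurable (lborel \<Otimes>\<^sub>M lborel)"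
    "(\<lambda>(x, y). norm (X y - x) * p x * \<theta> y) \<in> borel_measurable (lborel \<Otimes>\<^sub>M lborel)"
    by (simp_all only:) measurable
qed

text \<open>The second moment of \<open>p\<close> about \<open>x\<close> is \<open>2 V + |m - x|\<^sup>2\<close>, whose average over \<open>x\<close> is \<open>4 V\<close>; the sample
  variable contributes the factor \<open>C\<close>.\<close>

lemma integrable_displacement_square:
    "integrable (lborel \<Otimes>\<^sub>M lborel) (\<lambda>(x, y). (norm (X y - x))\<^sup>2 * p x * \<theta> y)"
  and displacement_square_le:
    "(\<integral>(x, y). (norm (X y - x))\<^sup>2 * p x * \<theta> y \<partial>(lborel \<Otimes>\<^sub>M lborel)) \<le> 4 * V * C"
proof -
  let ?f = "\<lambda>(x, y). (norm (X y - x))\<^sup>2 * p x * \<theta> y"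
  let ?h = "\<lambda>(x, y). ((2 * V + (norm (x - m))\<^sup>2) * p x) * (\<Gamma> y * \<theta> y)"
  have "(\<integral>x. (2 * V + (norm (x - m))\<^sup>2) * p x \<partial>lborel) = 4 * V"
    and "integrable lborel (\<lambda>x. (2 * V + (norm (x - m))\<^sup>2) * p x)"
    using second_moment(1)[of m] second_moment_about_eq[of m] p_density by (simp_all add: distrib_right)
  from this(1) pair_times[OF this(2) \<Gamma>(1)]
  have h: "has_bochner_integral (lborel \<Otimes>\<^sub>M lborel) ?h (4 * V * C)" by (simp add: C)
  have le: "?f z \<le> ?h z" "0 \<le> ?f z" for z
  proof -
    obtain x y where z: "z = (x, y)" by (cases z)
    show "0 \<le> ?f z" using z p_density \<theta>_density by simp
    have "(norm (X y - x))\<^sup>2 * \<theta> y \<le> (\<Gamma> y * (2 * V + (norm (x - m))\<^sup>2)) * \<theta> y"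
      using dist[of y x] \<theta>_density(2)[of y] second_moment_about_eq[of x]
      by (cases "\<theta> y = 0") (auto simp: norm_minus_commute intro!: mult_right_mono)
    from mult_right_mono[OF this p_density(2)[of x]]
    show "?f z \<le> ?h z" unfolding z by (simp add: mult.assoc mult.commute mult.left_commute)
  qed
  show f: "integrable (lborel \<Otimes>\<^sub>M lborel) ?f"
  proof (rule Bochner_Integration.integrable_bound)
    show "integrable (lborel \<Otimes>\<^sub>M lborel) ?h" using h by (rule integrable.intros)
    show "?f \<in> borel_measurable (lborel \<Otimes>\<^sub>M lborel)" by (rule borel_measurable_displacement)
    have "norm (?f z) \<le> norm (?h z)" for z
      using le[of z] unfolding real_norm_def by linarith
    then show "AE z in lborel \<Otimes>\<^sub>M lborel. norm (?f z) \<le> norm (?h z)" by simp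
  qed
  show "integral\<^sup>L (lborel \<Otimes>\<^sub>M lborel) ?f \<le> 4 * V * C"
    by (rule has_bochner_integral_le[OF has_bochner_integral_integrable[OF f] h]) (rule le(1))
qed

lemma integrable_displacement_norm:
    "integrable (lborel \<Otimes>\<^sub>M lborel) (\<lambda>(x, y). norm (X y - x) * p x * \<theta> y)"
  and displacement_norm_le:
    "(\<integral>(x, y). norm (X y - x) * p x * \<theta> y \<partial>(lborel \<Otimes>\<^sub>M lborel)) \<le> 2 * sqrt C * sqrt V"
proof -
  let ?\<rho> = "\<lambda>(x, y). p x * \<theta> y" and ?u = "\<lambda>(x, y). norm (X y - x)"
  have "has_bochner_integral (lborel \<Otimes>\<^sub>M lborel) ?\<rho> (1 * 1)"
    using pair_times[OF p_density(3) \<theta>_density(3)] by (simp add: p_density \<theta>_density)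
  then have \<rho>: "integrable (lborel \<Otimes>\<^sub>M lborel) ?\<rho>" "integral\<^sup>L (lborel \<Otimes>\<^sub>M lborel) ?\<rho> = 1"
    by (simp_all add: has_bochner_integral_iff)
  have \<rho>_nn: "0 \<le> ?\<rho> z" for z using p_density \<theta>_density by (cases z) simp
  have e1: "(\<lambda>z. ?u z * ?\<rho> z) = (\<lambda>(x, y). norm (X y - x) * p x * \<theta> y)"
    and e2: "(\<lambda>z. (?u z)\<^sup>2 * ?\<rho> z) = (\<lambda>(x, y). (norm (X y - x))\<^sup>2 * p x * \<theta> y)"
    by (simp_all add: fun_eq_iff)
  show int: "integrable (lborel \<Otimes>\<^sub>M lborel) (\<lambda>(x, y). norm (X y - x) * p x * \<theta> y)"
    using integrable_of_second_moment[where u = ?u, OF \<rho>(1) \<rho>_nn, unfolded e1 e2]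
      borel_measurable_displacement integrable_displacement_square by blast
  have "(\<integral>z. ?u z * ?\<rho> z \<partial>(lborel \<Otimes>\<^sub>M lborel)) \<le> sqrt (\<integral>z. (?u z)\<^sup>2 * ?\<rho> z \<partial>(lborel \<Otimes>\<^sub>M lborel))"
    by (rule integral_le_sqrt_second_moment)
       (use \<rho> \<rho>_nn int integrable_displacement_square in \<open>simp_all only: e1 e2\<close>)
  also have "\<dots> \<le> sqrt (4 * V * C)"
    unfolding e2 using displacement_square_le by (rule real_sqrt_le_mono)
  also have "\<dots> = 2 * sqrt C * sqrt V" by (simp add: real_sqrt_mult)
  finally show "(\<integral>(x, y). norm (X y - x) * p x * \<theta> y \<partial>(lborel \<Otimes>\<^sub>M lborel)) \<le> 2 * sqrt C * sqrt V"
    unfolding e1 .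
qed

text \<open>Split \<open>X y - x = (X y - m) - (x - m)\<close>. Positions and samples are independent and \<open>x - m\<close> has mean zero,
  so the first part averages out.\<close>

lemma displacement_correlation:
  "has_bochner_integral (lborel \<Otimes>\<^sub>M lborel) (\<lambda>(x, y). ((x - m) \<bullet> (X y - x)) * p x * \<theta> y) (- 2 * V)"
proof -
  have a: "integrable lborel (\<lambda>x. (x - m) $ i * p x)" "(\<integral>x. (x - m) $ i * p x \<partial>lborel) = 0" for i
    using coord[of i] p_density by (simp_all add: left_diff_distrib mean_nth)
  have b: "integrable lborel (\<lambda>y. (X y - m) $ i * \<theta> y)" for i
    using integrable_consensus[of i] \<theta>_density by (simp add: left_diff_distrib)
  have "has_bochner_integral (lborel \<Otimes>\<^sub>M lborel)
     (\<lambda>z. (\<Sum>i\<in>UNIV. (\<lambda>(x, y). ((x - m) $ i * p x) * ((X y - m) $ i * \<theta> y)) z)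
        - (\<lambda>(x, y). ((norm (x - m))\<^sup>2 * p x) * \<theta> y) z)
     ((\<Sum>i\<in>(UNIV::'d set). 0) - 2 * V)"
  proof (intro has_bochner_integral_diff has_bochner_integral_sum)
    show "has_bochner_integral (lborel \<Otimes>\<^sub>M lborel)
        (\<lambda>(x, y). ((x - m) $ i * p x) * ((X y - m) $ i * \<theta> y)) 0" for i
      using pair_times[OF a(1) b] by (simp only: a(2) mult_zero_left)
    show "has_bochner_integral (lborel \<Otimes>\<^sub>M lborel) (\<lambda>(x, y). ((norm (x - m))\<^sup>2 * p x) * \<theta> y) (2 * V)"
      using pair_times[OF second_moment(1)[of m] \<theta>_density(3)] second_moment_about_eq[of m] by (simp add: \<theta>_density)
  qed
  moreover have "(\<Sum>i\<in>UNIV. ((x - m) $ i * p x) * ((X y - m) $ i * \<theta> y)) - ((norm (x - m))\<^sup>2 * p x) * \<theta> y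
      = ((x - m) \<bullet> (X y - x)) * p x * \<theta> y" for x y
  proof -
    have "(\<Sum>i\<in>UNIV. ((x - m) $ i * p x) * ((X y - m) $ i * \<theta> y)) = ((x - m) \<bullet> (X y - m)) * p x * \<theta> y"
      unfolding inner_vec_def sum_distrib_right
      by (intro sum.cong) (simp_all only: inner_real_def mult_ac)
    moreover have "(x - m) \<bullet> (X y - x) = (x - m) \<bullet> (X y - m) - (norm (x - m))\<^sup>2"
      by (simp add: power2_norm_eq_inner inner_diff_right)
    ultimately show ?thesis by (simp add: left_diff_distrib)
  qed
  ultimately show ?thesis by (simp add: split_def)
qed

lemma abs_drift_le:
  "\<bar>\<integral>(x, y). (X y - x) $ i * p x * \<theta> y \<partial>(lborel \<Otimes>\<^sub>M lborel)\<bar> \<le> 2 * sqrt C * sqrt V"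
proof -
  have "norm (\<integral>(x, y). (X y - x) $ i * p x * \<theta> y \<partial>(lborel \<Otimes>\<^sub>M lborel))
      \<le> (\<integral>(x, y). norm (X y - x) * p x * \<theta> y \<partial>(lborel \<Otimes>\<^sub>M lborel))"
  proof (rule order_trans[OF integral_norm_bound integral_mono[OF integrable_norm[OF drift] integrable_displacement_norm]])
    fix z :: "(real^'d) \<times> 's"
    obtain x y where z: "z = (x, y)" by (cases z)
    have "\<bar>(X y - x) $ i\<bar> * p x * \<theta> y \<le> norm (X y - x) * p x * \<theta> y"
      using p_density(2) \<theta>_density(2) by (intro mult_right_mono component_le_norm_cart) auto
    then show "norm ((\<lambda>(x, y). (X y - x) $ i * p x * \<theta> y) z) \<le> (\<lambda>(x, y). norm (X y - x) * p x * \<theta> y) z"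
      using p_density(2) \<theta>_density(2) by (simp add: z abs_mult)
  qed
  then show ?thesis using displacement_norm_le by simp
qed

text \<open>The left-hand side is the rate of change of \<open>2 V = \<integral> |x|\<^sup>2 p - |m|\<^sup>2\<close>. Subtracting the contribution of
  the mean turns \<open>x \<bullet> (X y - x)\<close> into \<open>(x - m) \<bullet> (X y - x)\<close>, whose average is \<open>- 2 V\<close>.\<close>

lemma energy_production_le:
  assumes "0 \<le> k"
  shows "(\<integral>(x, y). 2 * lam * ((x \<bullet> (X y - x)) * p x * \<theta> y) + k * ((norm (X y - x))\<^sup>2 * p x * \<theta> y)
        \<partial>(lborel \<Otimes>\<^sub>M lborel))
      - 2 * (\<Sum>i\<in>UNIV. m $ i * (lam * (\<integral>(x, y). (X y - x) $ i * p x * \<theta> y \<partial>(lborel \<Otimes>\<^sub>M lborel))))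
    \<le> - 2 * (2 * lam - 2 * k * C) * V"
proof -
  let ?M = "lborel \<Otimes>\<^sub>M lborel :: ((real^'d) \<times> 's) measure"
  let ?d = "\<lambda>i. \<lambda>(x, y). (X y - x) $ i * p x * \<theta> y"
  let ?c = "\<lambda>(x, y). ((x - m) \<bullet> (X y - x)) * p x * \<theta> y"
  let ?s = "\<lambda>(x, y). (norm (X y - x))\<^sup>2 * p x * \<theta> y"
  have "has_bochner_integral ?M
      (\<lambda>z. (2 * lam * ?c z + 2 * (\<Sum>i\<in>UNIV. m $ i * (lam * ?d i z))) + k * ?s z)
      ((2 * lam * (- 2 * V) + 2 * (\<Sum>i\<in>UNIV. m $ i * (lam * integral\<^sup>L ?M (?d i)))) + k * integral\<^sup>L ?M ?s)"
    by (intro has_bochner_integral_add has_bochner_integral_mult_right has_bochner_integral_sum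
          displacement_correlation has_bochner_integral_integrable drift integrable_displacement_square)
  moreover have "(\<lambda>z. (2 * lam * ?c z + 2 * (\<Sum>i\<in>UNIV. m $ i * (lam * ?d i z))) + k * ?s z)
      = (\<lambda>(x, y). 2 * lam * ((x \<bullet> (X y - x)) * p x * \<theta> y) + k * ((norm (X y - x))\<^sup>2 * p x * \<theta> y))"
  proof -
    have E: "(\<Sum>i\<in>UNIV. m $ i * (lam * ((X y - x) $ i * p x * \<theta> y))) = lam * ((m \<bullet> (X y - x)) * p x * \<theta> y)" for x y
      unfolding inner_vec_def sum_distrib_right sum_distrib_left
      by (intro sum.cong) (simp_all only: inner_real_def mult_ac)
    show ?thesis
      by (intro ext, clarify) (simp only: split_conv E inner_diff_left, simp add: algebra_simps)
  qed
  ultimately have "(\<integral>(x, y). 2 * lam * ((x \<bullet> (X y - x)) * p x * \<theta> y) + k * ((norm (X y - x))\<^sup>2 * p x * \<theta> y) \<partial>?M)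
      = (2 * lam * (- 2 * V) + 2 * (\<Sum>i\<in>UNIV. m $ i * (lam * integral\<^sup>L ?M (?d i)))) + k * integral\<^sup>L ?M ?s"
    by (simp add: has_bochner_integral_iff)
  moreover have "k * integral\<^sup>L ?M ?s \<le> k * (4 * V * C)"
    using assms by (intro mult_left_mono displacement_square_le)
  ultimately show ?thesis by (simp add: algebra_simps)
qed

text \<open>Used for the collision term of the Gibbs weight, whose pointwise lower bound has this shape.\<close>

lemma integral_ge_of_displacement_bound:
  assumes H: "integrable (lborel \<Otimes>\<^sub>M lborel) H"
    "\<And>x y. - (a * norm (X y - x) + b * (norm (X y - x))\<^sup>2) * p x * \<theta> y \<le> H (x, y)"
    and ab: "0 \<le> a" "0 \<le> b"
  shows "- (2 * a * sqrt C * sqrt V + 4 * b * V * C) \<le> integral\<^sup>L (lborel \<Otimes>\<^sub>M lborel) H"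
proof -
  let ?M = "lborel \<Otimes>\<^sub>M lborel :: ((real^'d) \<times> 's) measure"
  let ?n = "\<lambda>(x, y). norm (X y - x) * p x * \<theta> y"
  let ?s = "\<lambda>(x, y). (norm (X y - x))\<^sup>2 * p x * \<theta> y"
  have "- a * integral\<^sup>L ?M ?n + - b * integral\<^sup>L ?M ?s \<le> integral\<^sup>L ?M H"
  proof (rule has_bochner_integral_le)
    show "has_bochner_integral ?M (\<lambda>z. - a * ?n z + - b * ?s z) (- a * integral\<^sup>L ?M ?n + - b * integral\<^sup>L ?M ?s)"
      by (intro has_bochner_integral_add has_bochner_integral_mult_right has_bochner_integral_integrable
            integrable_displacement_norm integrable_displacement_square)
    show "has_bochner_integral ?M H (integral\<^sup>L ?M H)" using H(1) by (rule has_bochner_integral_integrable)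
    show "- a * ?n z + - b * ?s z \<le> H z" for z
      using H(2)[of "snd z" "fst z"] by (simp add: split_def algebra_simps)
  qed
  moreover have "a * integral\<^sup>L ?M ?n \<le> a * (2 * sqrt C * sqrt V)"
    using ab by (intro mult_left_mono displacement_norm_le)
  moreover have "b * integral\<^sup>L ?M ?s \<le> b * (4 * V * C)"
    using ab by (intro mult_left_mono displacement_square_le)
  ultimately show ?thesis by (simp add: algebra_simps)
qed

end

section \<open>Differential inequalities on the positive half-line\<close>

text \<open>The solution is only known to attain its initial datum as a limit, so the comparison starts from
  a limit at \<open>0\<close> instead of a value.\<close>

lemma nonincreasing_le_initial_limit:
  fixes h :: "real \<Rightarrow> real"
  assumes d: "\<And>s. 0 < s \<Longrightarrow> (h has_real_derivative h' s) (at s)" "\<And>s. 0 < s \<Longrightarrow> h' s \<le> 0"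
    and lim: "(h \<longlongrightarrow> h0) (at_right 0)" and t: "0 < t"
  shows "h t \<le> h0"
proof (rule tendsto_lowerbound[OF lim])
  have "h t \<le> h s" if "0 < s" "s < t" for s
    by (rule DERIV_nonpos_imp_nonincreasing[of s t h])
       (use that d in \<open>auto intro: order_less_le_trans intro!: exI[of _ "h' _"]\<close>)
  then show "\<forall>\<^sub>F s in at_right 0. h t \<le> h s"
    using t unfolding eventually_at_right_field by (intro exI[of _ t]) auto
qed simp

lemma gronwall_from_initial_limit:
  fixes v :: "real \<Rightarrow> real"
  assumes d: "\<And>s. 0 < s \<Longrightarrow> (v has_real_derivative v' s) (at s)" "\<And>s. 0 < s \<Longrightarrow> v' s \<le> - \<mu> * v s"
    and lim: "(v \<longlongrightarrow> v0) (at_right 0)" and t: "0 < t"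
  shows "v t \<le> v0 * exp (- \<mu> * t)"
proof -
  have "v t * exp (\<mu> * t) \<le> v0"
  proof (rule nonincreasing_le_initial_limit[where h' = "\<lambda>s. (v' s + \<mu> * v s) * exp (\<mu> * s)", OF _ _ _ t])
    show "((\<lambda>s. v s * exp (\<mu> * s)) has_real_derivative (v' s + \<mu> * v s) * exp (\<mu> * s)) (at s)"
      if "0 < s" for s
      by (rule derivative_eq_intros d that refl)+ (simp add: algebra_simps)
    show "(v' s + \<mu> * v s) * exp (\<mu> * s) \<le> 0" if "0 < s" for s
      using d(2)[OF that] by (intro mult_nonpos_nonneg) auto
    have "((\<lambda>s. v s * exp (\<mu> * s)) \<longlongrightarrow> v0 * exp (\<mu> * 0)) (at_right 0)"
      by (intro tendsto_intros lim)
    then show "((\<lambda>s. v s * exp (\<mu> * s)) \<longlongrightarrow> v0) (at_right 0)" by simp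
  qed
  then have "v t * exp (\<mu> * t) * exp (- \<mu> * t) \<le> v0 * exp (- \<mu> * t)" by (rule mult_right_mono) simp
  then show ?thesis by (simp add: mult.assoc exp_add[symmetric])
qed

text \<open>With \<open>e(s) = (K / r) exp (- r s)\<close>, a primitive of minus the bound, \<open>v + e\<close> is nonincreasing and
  \<open>v - e\<close> is nondecreasing; so \<open>v + e\<close> is bounded below and converges, and \<open>e\<close> tends to zero.\<close>

lemma convergent_of_exp_bounded_derivative:
  fixes v :: "real \<Rightarrow> real"
  assumes d: "\<And>s. 0 < s \<Longrightarrow> (v has_real_derivative v' s) (at s)"
    "\<And>s. 0 < s \<Longrightarrow> \<bar>v' s\<bar> \<le> K * exp (- r * s)" and r: "0 < r"
  shows "\<exists>l. (v \<longlongrightarrow> l) at_top"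
proof -
  define e where "e s = K / r * exp (- r * s)" for s
  have e': "(e has_real_derivative - K * exp (- r * s)) (at s)" for s
    unfolding e_def using r by (auto intro!: derivative_eq_intros)
  have K: "0 \<le> K"
    using d(2)[of 1] by (metis abs_ge_zero exp_gt_zero order_trans zero_le_mult_iff zero_less_one not_less)
  then have e0: "0 \<le> e s" for s using r by (simp add: e_def)
  have e_lim: "(e \<longlongrightarrow> 0) at_top"
  proof -
    have "filterlim (\<lambda>s. - r * s) at_bot at_top"
      using r by (intro filterlim_tendsto_neg_mult_at_bot[OF tendsto_const] filterlim_ident) auto
    then have "((\<lambda>s. exp (- r * s)) \<longlongrightarrow> 0) at_top" by (rule filterlim_compose[OF exp_at_bot])
    then have "((\<lambda>s. K / r * exp (- r * s)) \<longlongrightarrow> K / r * 0) at_top" by (intro tendsto_intros)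
    then show ?thesis by (simp add: e_def[abs_def])
  qed
  have up: "v t + e t \<le> v s + e s" if "0 < s" "s \<le> t" for s t
  proof (rule DERIV_nonpos_imp_nonincreasing[of s t "\<lambda>s. v s + e s"])
    fix x assume "s \<le> x" "x \<le> t"
    then have x: "0 < x" using that by simp
    then show "\<exists>y. ((\<lambda>s. v s + e s) has_real_derivative y) (at x) \<and> y \<le> 0"
      using d(2)[OF x] by (intro exI[of _ "v' x + - K * exp (- r * x)"] conjI DERIV_add d e') auto
  qed (use that in auto)
  have dn: "v s - e s \<le> v t - e t" if "0 < s" "s \<le> t" for s t
  proof (rule DERIV_nonneg_imp_nondecreasing[of s t "\<lambda>s. v s - e s"])
    fix x assume "s \<le> x" "x \<le> t"
    then have x: "0 < x" using that by simp
    then show "\<exists>y. ((\<lambda>s. v s - e s) has_real_derivative y) (at x) \<and> 0 \<le> y"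
      using d(2)[OF x] by (intro exI[of _ "v' x - - K * exp (- r * x)"] conjI DERIV_diff d e') auto
  qed (use that in auto)
  define l where "l = Inf ((\<lambda>s. v s + e s) ` {1..})"
  have lb: "v 1 - e 1 \<le> v s + e s" if "1 \<le> s" for s
    using dn[of 1 s] e0[of s] that by simp
  then have bdd: "bdd_below ((\<lambda>s. v s + e s) ` {1..})" by (auto intro!: bdd_belowI2)
  have "((\<lambda>s. v s + e s) \<longlongrightarrow> l) at_top"
  proof (rule decreasing_tendsto)
    show "\<forall>\<^sub>F s in at_top. l \<le> v s + e s"
      using eventually_ge_at_top[of 1] by eventually_elim (auto simp: l_def intro!: cInf_lower bdd)
    fix x assume "l < x"
    then obtain s where s: "1 \<le> s" "v s + e s < x"
      unfolding l_def using cInf_less_iff[OF _ bdd] by auto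
    show "\<forall>\<^sub>F t in at_top. v t + e t < x"
      using eventually_ge_at_top[of s]
    proof eventually_elim
      case (elim t)
      then show ?case using up[of s t] s by simp
    qed
  qed
  from tendsto_diff[OF this e_lim] show ?thesis by auto
qed

section \<open>Laplace principle\<close>

text \<open>On the neighbourhood \<open>U\<close> of \<open>xmin\<close> where \<open>f < f xmin + \<epsilon> / 2\<close>, which carries positive mass \<open>q\<close>, the weight
  is at least \<open>exp (- \<alpha> (f xmin + \<epsilon> / 2))\<close>. Thus the gap lies between \<open>0\<close> and
  \<open>\<epsilon> / 2 - ln q / \<alpha>\<close>.\<close>

lemma laplace_principle:
  fixes f g0 :: "real^'d::finite \<Rightarrow> real"
  assumes g0: "prob_density g0" and f: "continuous_on UNIV f" and xmin: "\<And>x. f xmin \<le> f x"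
    and supp: "xmin \<in> density_support g0"
  shows "(laplace_gap f g0 xmin \<longlongrightarrow> 0) at_top"
proof (rule tendstoI)
  fix \<epsilon> :: real assume \<epsilon>: "0 < \<epsilon>"
  have g0D: "g0 \<in> borel_measurable borel" "\<And>x. 0 \<le> g0 x" "integrable lborel g0" "(\<integral>x. g0 x \<partial>lborel) = 1"
    using g0 by (auto simp: prob_density_def)
  have fm: "f \<in> borel_measurable borel" using f by (rule borel_measurable_continuous_onI)
  note [measurable] = g0D(1) fm
  define U where "U = {x. f x < f xmin + \<epsilon> / 2}"
  have U: "open U" unfolding U_def using f by (intro open_Collect_less) auto
  have [measurable]: "U \<in> sets borel" using U by simp
  define q where "q = (LINT z:U|lborel. g0 z)"
  have q: "0 < q" using supp U \<epsilon> by (auto simp: density_support_def q_def U_def)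
  have ev: "\<forall>\<^sub>F \<alpha> in at_top. - ln q / (\<epsilon> / 2) < \<alpha> \<and> 0 < \<alpha>"
    using eventually_gt_at_top by (intro eventually_conj) auto
  then show "\<forall>\<^sub>F \<alpha> in at_top. dist (laplace_gap f g0 xmin \<alpha>) 0 < \<epsilon>"
  proof eventually_elim
    case (elim \<alpha>)
    define W where "W = weight_norm \<alpha> f g0"
    have int: "integrable lborel (\<lambda>x. exp (- \<alpha> * f x) * g0 x)"
      using g0D xmin elim
      by (intro Bochner_Integration.integrable_bound[OF integrable_mult_right[OF g0D(3), of "exp (- \<alpha> * f xmin)"]])
         (auto simp: abs_mult intro!: mult_right_mono)
    have "W \<le> (\<integral>x. exp (- \<alpha> * f xmin) * g0 x \<partial>lborel)"
      unfolding W_def weight_norm_def using int g0D xmin elim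
      by (intro integral_mono) (auto intro!: mult_right_mono)
    then have up: "W \<le> exp (- \<alpha> * f xmin)" using g0D by simp
    have "(\<integral>x. exp (- \<alpha> * (f xmin + \<epsilon> / 2)) * (indicator U x *\<^sub>R g0 x) \<partial>lborel) \<le> W"
      unfolding W_def weight_norm_def
    proof (intro integral_mono int integrable_mult_right)
      show "integrable lborel (\<lambda>x. indicator U x *\<^sub>R g0 x)"
        using g0D by (intro integrable_mult_indicator) auto
      show "exp (- \<alpha> * (f xmin + \<epsilon> / 2)) * (indicator U x *\<^sub>R g0 x) \<le> exp (- \<alpha> * f x) * g0 x" for x
        using g0D(2)[of x] elim by (cases "x \<in> U") (auto simp: U_def intro!: mult_right_mono)
    qed
    then have lo: "exp (- \<alpha> * (f xmin + \<epsilon> / 2)) * q \<le> W"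
      by (simp add: q_def set_lebesgue_integral_def)
    have W0: "0 < W" using lo q by (meson exp_gt_zero mult_pos_pos order_less_le_trans)
    have "ln W \<le> - \<alpha> * f xmin" using up W0 by (metis ln_exp ln_le_cancel_iff exp_gt_zero)
    moreover have "- \<alpha> * (f xmin + \<epsilon> / 2) + ln q \<le> ln W"
    proof -
      have "ln (exp (- \<alpha> * (f xmin + \<epsilon> / 2)) * q) \<le> ln W"
        using lo q W0 by (subst ln_le_cancel_iff) auto
      then show ?thesis using q by (simp add: ln_mult)
    qed
    moreover have "- ln q < \<alpha> * (\<epsilon> / 2)" using elim \<epsilon> by (simp add: field_simps)
    ultimately have "0 \<le> - ln W - \<alpha> * f xmin" "- ln W - \<alpha> * f xmin < \<alpha> * \<epsilon>"
      by (simp_all add: algebra_simps)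
    moreover have "laplace_gap f g0 xmin \<alpha> = (- ln W - \<alpha> * f xmin) / \<alpha>"
      using elim by (simp add: laplace_gap_def W_def field_simps)
    ultimately have "0 \<le> laplace_gap f g0 xmin \<alpha>" "laplace_gap f g0 xmin \<alpha> < \<epsilon>"
      using elim by (simp_all add: pos_divide_less_eq mult.commute)
    then show ?case by simp
  qed
qed

section \<open>Convergence of the mean and quality of its limit\<close>

lemma weak_solutionD:
  assumes "weak_solution lam sig \<alpha> D F \<theta> T g0 g" "\<psi> \<in> T"
  shows "integrable lborel (\<lambda>x. \<psi> x * g0 x)"
    and "0 < t \<Longrightarrow> integrable lborel (\<lambda>x. \<psi> x * g t x)"
    and "0 < t \<Longrightarrow> integrable (lborel \<Otimes>\<^sub>M lborel) (collision_integrand lam sig \<alpha> D F \<theta> (g t) \<psi>)"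
    and "0 < t \<Longrightarrow> ((\<lambda>s. \<integral>x. \<psi> x * g s x \<partial>lborel) has_real_derivative
      (\<integral>z. collision_integrand lam sig \<alpha> D F \<theta> (g t) \<psi> z \<partial>(lborel \<Otimes>\<^sub>M lborel))) (at t)"
    and "((\<lambda>t. \<integral>x. \<psi> x * g t x \<partial>lborel) \<longlongrightarrow> (\<integral>x. \<psi> x * g0 x \<partial>lborel)) (at_right 0)"
  using assms by (simp_all add: weak_solution_def)

lemma sample_avg_mono:
  assumes "ys \<in> samples E" "\<And>y. y \<in> E \<Longrightarrow> h y \<le> k y"
  shows "sample_avg h ys \<le> sample_avg k ys"
  using assms by (auto simp: sample_avg_def samples_def intro!: divide_right_mono sum_mono)

lemma weak_solution_displacement:
  fixes F :: "real^'d::finite \<Rightarrow> real^'k \<Rightarrow> real" and \<theta> :: "real^'k^'m \<Rightarrow> real"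
  assumes g: "weak_solution lam sig \<alpha> D F \<theta> (test_functions \<alpha> f) g0 g"
    and \<theta>: "sample_density E \<theta>" and pos: "0 < lam" "0 < \<alpha>"
    and F: "\<And>x y. y \<in> E \<Longrightarrow> Flo y \<le> F x y \<and> F x y \<le> Fhi y"
    and F_cont: "\<And>y. y \<in> E \<Longrightarrow> continuous_on UNIV (\<lambda>x. F x y)"
    and int: "integrable lborel (\<lambda>ys. exp (\<alpha> * (sample_avg Fhi ys - sample_avg Flo ys)) * \<theta> ys)"
    and t: "0 < t"
  shows "displacement (g t) \<theta> (consensus \<alpha> F (g t))
    (\<lambda>ys. exp (\<alpha> * (sample_avg Fhi ys - sample_avg Flo ys))) (exp_gap_const \<alpha> Flo Fhi \<theta>)"
proof -
  have T: "(\<lambda>x. x $ i) \<in> test_functions \<alpha> f" "(\<lambda>x. (norm x)\<^sup>2) \<in> test_functions \<alpha> f" for i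
    by (auto simp: test_functions_def)
  have p: "prob_density (g t)" and coord: "\<And>i. integrable lborel (\<lambda>x. x $ i * g t x)"
    and square: "integrable lborel (\<lambda>x. (norm x)\<^sup>2 * g t x)"
    and coll: "\<And>i. integrable (lborel \<Otimes>\<^sub>M lborel) (collision_integrand lam sig \<alpha> D F \<theta> (g t) (\<lambda>x. x $ i))"
    using g t weak_solutionD[OF g T(1)] weak_solutionD[OF g T(2)] by (simp_all add: weak_solution_def)
  show ?thesis
  proof
    show "prob_density (g t)" "prob_density \<theta>" using p \<theta> by (auto simp: sample_density_def)
    show "integrable lborel (\<lambda>x. x $ i * g t x)" for i by (rule coord)
    show "integrable lborel (\<lambda>x. (norm x)\<^sup>2 * g t x)" by (rule square)
    show "integrable (lborel \<Otimes>\<^sub>M lborel) (\<lambda>(x, y). (consensus \<alpha> F (g t) y - x) $ i * g t x * \<theta> y)" for i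
    proof -
      have "integrable (lborel \<Otimes>\<^sub>M lborel)
          (\<lambda>z. lam * (\<lambda>(x, y). (consensus \<alpha> F (g t) y - x) $ i * g t x * \<theta> y) z)"
        using coll[of i] unfolding collision_coordinate by (simp add: split_def)
      then show ?thesis using pos by (simp only: integrable_mult_left_iff) auto
    qed
    fix x ys assume "\<theta> ys \<noteq> 0"
    then have ys: "ys \<in> samples E" using \<theta> by (auto simp: sample_density_def)
    have "continuous_on UNIV (\<lambda>x. sample_avg (F x) ys)"
      unfolding sample_avg_def using ys by (intro continuous_intros F_cont) (auto simp: samples_def)
    then have "(\<lambda>x. sample_avg (F x) ys) \<in> borel_measurable borel" by (rule borel_measurable_continuous_onI)
    then show "(norm (consensus \<alpha> F (g t) ys - x))\<^sup>2 \<le> exp (\<alpha> * (sample_avg Fhi ys - sample_avg Flo ys))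
        * (\<integral>z. (norm (z - x))\<^sup>2 * g t z \<partial>lborel)"
      using F ys by (intro consensus_dist_le p coord square pos sample_avg_mono[OF ys]) auto
  qed (use int in \<open>auto simp: exp_gap_const_def\<close>)
qed

theorem corollary2p10:
  fixes P :: "'w measure" and Y :: "'w \<Rightarrow> real^'k" and E :: "(real^'k) set"
    and F :: "real^'d \<Rightarrow> real^'k \<Rightarrow> real" and f :: "real^'d \<Rightarrow> real" and xmin :: "real^'d"
    and lawY :: "(real^'k) measure"
    and \<theta> :: "real^'k^'m \<Rightarrow> real"
    and lam sig \<alpha> \<kappa> :: real and D :: "real^'d \<Rightarrow> real^'d^'d"
    and g0 :: "real^'d \<Rightarrow> real" and g :: "real \<Rightarrow> real^'d \<Rightarrow> real"
    and Flo Fhi c1 c2 :: "real^'k \<Rightarrow> real"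
    and flo C1 C2 C\<alpha> \<mu> \<nu> :: real
  assumes P: "prob_space P"
    and Y: "Y \<in> measurable P (restrict_space borel E)"
    and lawY: "lawY = distr P (restrict_space borel E) Y"
    and F_meas: "\<And>x. F x \<in> borel_measurable (restrict_space borel E)"
    and F_int: "\<And>x. integrable P (\<lambda>w. F x (Y w))"
    and f_def: "f = (\<lambda>x. \<integral>w. F x (Y w) \<partial>P)"
    and xmin: "\<And>x. f xmin \<le> f x"
    and \<theta>: "sample_density E \<theta>"
    and pos: "0 < lam" "0 < sig" "0 < \<alpha>"
    and D_\<kappa>: "(D = isotropic \<and> \<kappa> = real CARD('d)) \<or> (D = anisotropic \<and> \<kappa> = 1)"
    and g: "weak_solution lam sig \<alpha> D F \<theta> (test_functions \<alpha> f) g0 g"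
    and A1: "\<And>x y. y \<in> E \<Longrightarrow> Flo y \<le> F x y \<and> F x y \<le> Fhi y"
    and A2_C2: "\<And>y. y \<in> E \<Longrightarrow> C_times 2 (\<lambda>x. F x y)"
    and A2_pos: "\<And>y. y \<in> E \<Longrightarrow> 0 < c1 y \<and> 0 < c2 y"
    and A2_grad: "\<And>x y. y \<in> E \<Longrightarrow> norm (grad (\<lambda>x. F x y) x) \<le> c1 y"
    and A2_hess: "\<And>x y. y \<in> E \<Longrightarrow> onorm ((*v) (hessian (\<lambda>x. F x y) x)) \<le> c2 y"
    and Fhi_meas: "Fhi \<in> borel_measurable (restrict_space borel E)"
    and ints: "integrable lawY Flo" "integrable lawY c1" "integrable lawY c2"
    and bounds_meas: "Flo \<in> borel_measurable (restrict_space borel E)"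
      "c1 \<in> borel_measurable (restrict_space borel E)"
      "c2 \<in> borel_measurable (restrict_space borel E)"
    and C\<alpha>_int:
      "integrable lborel (\<lambda>ys. exp (\<alpha> * (sample_avg Fhi ys - sample_avg Flo ys)) * \<theta> ys)"
    and C\<alpha>: "C\<alpha> = exp_gap_const \<alpha> Flo Fhi \<theta>"
    and flo: "flo = (\<integral>y. Flo y \<partial>lawY)"
    and C1: "C1 = (\<integral>y. c1 y \<partial>lawY)"
    and C2: "C2 = (\<integral>y. c2 y \<partial>lawY)"
    and \<mu>: "\<mu> = 2 * lam - 2 * (lam\<^sup>2 + \<kappa> * sig\<^sup>2) * C\<alpha>" "\<mu> > 0"
    and \<nu>: "\<nu> = 2 / (\<mu> * weight_norm \<alpha> f g0) * \<alpha> * exp (- \<alpha> * flo)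
               * (2 * lam * C1 * sqrt C\<alpha> + (lam\<^sup>2 + \<kappa> * sig\<^sup>2) * C2 * C\<alpha>)
               * max (sqrt (density_V g0)) (density_V g0)"
      "\<nu> < 1/2"
  shows "(\<exists>xt. ((\<lambda>t. density_mean (g t)) \<longlongrightarrow> xt) at_top
            \<and> f xt \<le> f xmin + laplace_gap f g0 xmin \<alpha> + ln 2 / \<alpha>)
         \<and> (xmin \<in> density_support g0 \<longrightarrow> (laplace_gap f g0 xmin \<longlongrightarrow> 0) at_top)"
proof -
  interpret P: prob_space P by (rule P)
  have Y_in: "Y w \<in> E" if "w \<in> space P" for w
    using measurable_space[OF Y that] by (simp add: space_restrict_space)
  have lawY_int: "integrable P (\<lambda>w. h (Y w))" "(\<integral>y. h y \<partial>lawY) = (\<integral>w. h (Y w) \<partial>P)"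
    if "integrable lawY h" for h :: "real^'k \<Rightarrow> real"
  proof -
    have "h \<in> borel_measurable (restrict_space borel E)"
      using borel_measurable_integrable[OF that] by (simp add: lawY)
    then show "integrable P (\<lambda>w. h (Y w))" "(\<integral>y. h y \<partial>lawY) = (\<integral>w. h (Y w) \<partial>P)"
      using that unfolding lawY by (auto intro: integrable_distr[OF Y] integral_distr[OF Y])
  qed
  have F_cont: "continuous_on UNIV (\<lambda>x. F x y)" if "y \<in> E" for y
    using A2_C2[OF that] by (intro continuous_at_imp_continuous_on)
      (auto simp: numeral_2_eq_2 intro: differentiable_imp_continuous_within)
  note regularity = expected_cost_regularity[where P = P and Y = Y and E = E, OF Y_in F_int f_def A2_C2
      A2_grad A2_hess lawY_int(1)[OF ints(2)] lawY_int(1)[OF ints(3)]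
      trans[OF C1 lawY_int(2)[OF ints(2)]] trans[OF C2 lawY_int(2)[OF ints(3)]]]
  have f_cont: "continuous_on UNIV f"
    by (rule lipschitz_on_continuous_on[of "max C1 0"])
       (auto intro!: lipschitz_onI order_trans[OF regularity(1)] mult_right_mono simp: dist_norm)
  have C1_0: "0 \<le> C1" and C2_0: "0 \<le> C2"
    unfolding C1 C2 lawY_int(2)[OF ints(2)] lawY_int(2)[OF ints(3)]
    using A2_pos Y_in by (simp_all add: less_imp_le Bochner_Integration.integral_nonneg)
  have f_ge: "flo \<le> f x" for x
    unfolding flo f_def lawY_int(2)[OF ints(1)]
    using A1 Y_in by (intro integral_mono lawY_int(1) ints F_int) auto

  define k where "k = lam\<^sup>2 + \<kappa> * sig\<^sup>2"
  have k: "0 \<le> k" using D_\<kappa> by (auto simp: k_def)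
  let ?\<omega> = "\<lambda>x. exp (- \<alpha> * f x)"
  define M where "M i s = (\<integral>x. x $ i * g s x \<partial>lborel)" for i s
  define S where "S s = (\<integral>x. (norm x)\<^sup>2 * g s x \<partial>lborel)" for s
  define W where "W s = (\<integral>x. ?\<omega> x * g s x \<partial>lborel)" for s
  \<comment> \<open>This agrees with the variance for \<open>s > 0\<close> and is differentiable by inspection.\<close>
  define v where "v s = (S s - (\<Sum>i\<in>UNIV. (M i s)\<^sup>2)) / 2" for s
  define V0 where "V0 = density_V g0"
  define W0 where "W0 = weight_norm \<alpha> f g0"
  let ?coll = "\<lambda>s \<psi>. \<integral>z. collision_integrand lam sig \<alpha> D F \<theta> (g s) \<psi> z \<partial>(lborel \<Otimes>\<^sub>M lborel)"

  have T: "(\<lambda>x. x $ i) \<in> test_functions \<alpha> f" "(\<lambda>x. (norm x)\<^sup>2) \<in> test_functions \<alpha> f"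
      "?\<omega> \<in> test_functions \<alpha> f" for i
    by (auto simp: test_functions_def)
  have g0: "prob_density g0" using g by (simp add: weak_solution_def)
  interpret g0: square_integrable_density g0
    by (intro square_integrable_density.intro g0 weak_solutionD(1)[OF g] T)
  have \<omega>_int: "integrable lborel (\<lambda>x. ?\<omega> x * g0 x)" "\<And>s. 0 < s \<Longrightarrow> integrable lborel (\<lambda>x. ?\<omega> x * g s x)"
    "\<And>s. 0 < s \<Longrightarrow> integrable (lborel \<Otimes>\<^sub>M lborel) (collision_integrand lam sig \<alpha> D F \<theta> (g s) ?\<omega>)"
    by (rule weak_solutionD[OF g T(3)], assumption?)+
  have M': "(M i has_real_derivative ?coll s (\<lambda>x. x $ i)) (at s)"
    and S': "(S has_real_derivative ?coll s (\<lambda>x. (norm x)\<^sup>2)) (at s)"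
    and W': "(W has_real_derivative ?coll s ?\<omega>) (at s)" if "0 < s" for s i
    unfolding M_def[abs_def] S_def[abs_def] W_def[abs_def]
    by (rule weak_solutionD(4)[OF g T(1) that] weak_solutionD(4)[OF g T(2) that]
        weak_solutionD(4)[OF g T(3) that])+
  have lims: "(M i \<longlongrightarrow> (\<integral>x. x $ i * g0 x \<partial>lborel)) (at_right 0)"
    "(S \<longlongrightarrow> (\<integral>x. (norm x)\<^sup>2 * g0 x \<partial>lborel)) (at_right 0)" "(W \<longlongrightarrow> W0) (at_right 0)" for i
    unfolding M_def[abs_def] S_def[abs_def] W_def[abs_def] W0_def weight_norm_def
    by (rule weak_solutionD(5)[OF g T(1)] weak_solutionD(5)[OF g T(2)] weak_solutionD(5)[OF g T(3)])+
  have disp: "displacement (g s) \<theta> (consensus \<alpha> F (g s))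
    (\<lambda>ys. exp (\<alpha> * (sample_avg Fhi ys - sample_avg Flo ys))) C\<alpha>" if "0 < s" for s
    unfolding C\<alpha> by (rule weak_solution_displacement[OF g \<theta> pos(1,3) A1 F_cont C\<alpha>_int that])
  have C0: "0 \<le> C\<alpha>" using displacement.C_nonneg[OF disp[of 1]] by simp
  have norm_sq: "(norm z)\<^sup>2 = (\<Sum>i\<in>UNIV. (z $ i)\<^sup>2)" for z :: "real^'d"
    unfolding power2_norm_eq_inner by (simp add: inner_vec_def power2_eq_square)

  have v_eq: "v s = density_V (g s)" and M_eq: "M i s = density_mean (g s) $ i" if "0 < s" for s i
  proof -
    interpret displacement "g s" \<theta> "consensus \<alpha> F (g s)"
      "\<lambda>ys. exp (\<alpha> * (sample_avg Fhi ys - sample_avg Flo ys))" C\<alpha> by (rule disp[OF that])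
    show "v s = density_V (g s)" unfolding V_eq norm_sq[of "density_mean (g s)"] mean_nth v_def S_def M_def ..
    show "M i s = density_mean (g s) $ i" unfolding mean_nth M_def ..
  qed
  have v_lim: "(v \<longlongrightarrow> V0) (at_right 0)"
    unfolding V0_def g0.V_eq norm_sq[of "density_mean g0"] g0.mean_nth v_def[abs_def]
    by (intro tendsto_intros lims) auto

  have v_decay: "v t \<le> V0 * exp (- \<mu> * t)" if "0 < t" for t
  proof (rule gronwall_from_initial_limit[OF _ _ v_lim that])
    fix s :: real assume s: "0 < s"
    interpret displacement "g s" \<theta> "consensus \<alpha> F (g s)"
      "\<lambda>ys. exp (\<alpha> * (sample_avg Fhi ys - sample_avg Flo ys))" C\<alpha> by (rule disp[OF s])
    let ?v' = "(?coll s (\<lambda>x. (norm x)\<^sup>2) - (\<Sum>i\<in>UNIV. 2 * M i s * ?coll s (\<lambda>x. x $ i))) / 2"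
    show "(v has_real_derivative ?v') (at s)"
      unfolding v_def[abs_def] by (auto intro!: derivative_eq_intros M'[OF s] S'[OF s] simp: mult_ac)
    have "(\<Sum>i\<in>UNIV. 2 * M i s * ?coll s (\<lambda>x. x $ i)) = 2 * (\<Sum>i\<in>UNIV. m $ i * (lam *
        (\<integral>(x, y). (consensus \<alpha> F (g s) y - x) $ i * g s x * \<theta> y \<partial>(lborel \<Otimes>\<^sub>M lborel))))"
      unfolding sum_distrib_left collision_coordinate by (simp add: M_eq[OF s] split_def mult.assoc)
    then have "2 * ?v' \<le> - 2 * (2 * lam - 2 * k * C\<alpha>) * V"
      unfolding collision_norm_square[OF D_\<kappa>] k_def[symmetric]
      using energy_production_le[OF k, of lam] by simp
    also have "2 * lam - 2 * k * C\<alpha> = \<mu>" by (simp add: \<mu> k_def)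
    finally show "?v' \<le> - \<mu> * v s" by (simp add: v_eq[OF s])
  qed
  have V0: "0 \<le> V0" unfolding V0_def by (rule g0.V_nonneg)
  have v0: "0 \<le> v s" if "0 < s" for s
    using displacement.axioms(1)[OF disp[OF that]] square_integrable_density.V_nonneg v_eq[OF that] by metis
  have sqrt_v_decay: "sqrt (v t) \<le> sqrt V0 * exp (- (\<mu> / 2) * t)" if "0 < t" for t
  proof -
    have "sqrt (v t) \<le> sqrt (V0 * exp (- \<mu> * t))" using v_decay[OF that] by (rule real_sqrt_le_mono)
    also have "exp (- \<mu> * t) = (exp (- (\<mu> / 2) * t))\<^sup>2" by (simp add: power2_eq_square exp_add[symmetric])
    finally show ?thesis by (simp add: real_sqrt_mult)
  qed

  have "\<exists>l. (M i \<longlongrightarrow> l) at_top" for i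
  proof (rule convergent_of_exp_bounded_derivative[OF M'])
    fix s :: real assume s: "0 < s"
    interpret displacement "g s" \<theta> "consensus \<alpha> F (g s)"
      "\<lambda>ys. exp (\<alpha> * (sample_avg Fhi ys - sample_avg Flo ys))" C\<alpha> by (rule disp[OF s])
    have "\<bar>?coll s (\<lambda>x. x $ i)\<bar> \<le> lam * (2 * sqrt C\<alpha> * sqrt V)"
      unfolding collision_coordinate using abs_drift_le[of i] pos(1)
      by (simp add: split_def abs_mult)
    also have "\<dots> \<le> lam * (2 * sqrt C\<alpha> * (sqrt V0 * exp (- (\<mu> / 2) * s)))"
      using pos(1) C0 sqrt_v_decay[OF s] v_eq[OF s] by (intro mult_left_mono) auto
    finally show "\<bar>?coll s (\<lambda>x. x $ i)\<bar> \<le> (lam * 2 * sqrt C\<alpha> * sqrt V0) * exp (- (\<mu> / 2) * s)"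
      by (simp add: mult.assoc)
  qed (use \<mu> in auto)
  then obtain l where l: "\<And>i. (M i \<longlongrightarrow> l i) at_top" by metis
  define xt where "xt = (\<chi> i. l i)"
  have m_lim: "((\<lambda>t. density_mean (g t)) \<longlongrightarrow> xt) at_top"
  proof (rule vec_tendstoI)
    fix i
    show "((\<lambda>t. density_mean (g t) $ i) \<longlongrightarrow> xt $ i) at_top"
      using l[of i] unfolding xt_def vec_lambda_beta
      by (rule Lim_transform_eventually)
         (use eventually_gt_at_top[of "0::real"] in \<open>eventually_elim, simp add: M_eq\<close>)
  qed
  have v_tendsto: "(v \<longlongrightarrow> 0) at_top"
  proof (rule tendsto_sandwich[OF _ _ tendsto_const])
    show "\<forall>\<^sub>F t in at_top. 0 \<le> v t"
      using eventually_gt_at_top[of 0] by eventually_elim (rule v0)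
    show "\<forall>\<^sub>F t in at_top. v t \<le> V0 * exp (- \<mu> * t)"
      using eventually_gt_at_top[of 0] by eventually_elim (rule v_decay)
    have "filterlim (\<lambda>s. - \<mu> * s) at_bot at_top"
      using \<mu>(2) by (intro filterlim_tendsto_neg_mult_at_bot[OF tendsto_const] filterlim_ident) auto
    then have "((\<lambda>s. exp (- \<mu> * s)) \<longlongrightarrow> 0) at_top" by (rule filterlim_compose[OF exp_at_bot])
    from tendsto_mult_left[OF this, of V0] show "((\<lambda>t. V0 * exp (- \<mu> * t)) \<longlongrightarrow> 0) at_top" by simp
  qed

  have W0: "0 < W0"
  proof -
    have nn: "0 \<le> ?\<omega> x * g0 x" for x using g0.p_density by simp
    \<comment> \<open>A vanishing integral of a positive weight would force \<open>g0\<close> to vanish almost everywhere.\<close>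
    have "W0 \<noteq> 0"
    proof
      assume "W0 = 0"
      then have "AE x in lborel. ?\<omega> x * g0 x = 0"
        using \<omega>_int(1) nn by (simp add: W0_def weight_norm_def integral_nonneg_eq_0_iff_AE)
      then have "AE x in lborel. g0 x = 0" by simp
      then have "(\<integral>x. g0 x \<partial>lborel) = 0" by (rule integral_eq_zero_AE)
      then show False using g0.p_density by simp
    qed
    moreover have "0 \<le> W0" unfolding W0_def weight_norm_def using nn by (simp add: Bochner_Integration.integral_nonneg)
    ultimately show ?thesis by simp
  qed

  define A where "A = \<alpha> * exp (- \<alpha> * flo)"
  have A: "0 < A" using pos by (simp add: A_def)
  \<comment> \<open>The rate at which \<open>W\<close> can decrease is at most
    \<open>B1 exp (- \<mu> s / 2) + B2 exp (- \<mu> s)\<close>; the two terms stem from the drift and from the mean square of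
    the jumps.\<close>
  define B1 where "B1 = A * (2 * (lam * C1) * sqrt C\<alpha>) * sqrt V0"
  define B2 where "B2 = A * (2 * k * C2 * C\<alpha>) * V0"
  have B0: "0 \<le> B1" "0 \<le> B2"
    using A pos C1_0 C2_0 C0 V0 k by (auto simp: B1_def B2_def)
  have W'_ge: "- (B1 * exp (- (\<mu> / 2) * s) + B2 * exp (- \<mu> * s)) \<le> ?coll s ?\<omega>" if s: "0 < s" for s
  proof -
    interpret displacement "g s" \<theta> "consensus \<alpha> F (g s)"
      "\<lambda>ys. exp (\<alpha> * (sample_avg Fhi ys - sample_avg Flo ys))" C\<alpha> by (rule disp[OF s])
    have rate: "- (A * (lam * C1) * r + A * (k * C2 / 2) * r\<^sup>2) = - A * (lam * C1 * r + k * C2 / 2 * r\<^sup>2)" for r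
      by (simp add: algebra_simps)
    have "- (2 * (A * (lam * C1)) * sqrt C\<alpha> * sqrt V + 4 * (A * (k * C2 / 2)) * V * C\<alpha>) \<le> ?coll s ?\<omega>"
    proof (rule integral_ge_of_displacement_bound)
      show "integrable (lborel \<Otimes>\<^sub>M lborel) (collision_integrand lam sig \<alpha> D F \<theta> (g s) ?\<omega>)"
        by (rule \<omega>_int(3)[OF s])
      fix x ys
      obtain G where "norm G \<le> C1" "\<And>u. f (x + u) \<le> f x + G \<bullet> u + C2 / 2 * (norm u)\<^sup>2"
        using regularity(2)[of x] by blast
      from collision_exp_lower_bound[where p = "g s" and x = x and \<theta> = \<theta> and ys = ys and F = F,
          OF D_\<kappa> pos(1,3) C2_0 p_density(2) \<theta>_density(2) f_cont f_ge this]
      show "- (A * (lam * C1) * norm (consensus \<alpha> F (g s) ys - x)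
          + A * (k * C2 / 2) * (norm (consensus \<alpha> F (g s) ys - x))\<^sup>2) * g s x * \<theta> ys
        \<le> collision_integrand lam sig \<alpha> D F \<theta> (g s) ?\<omega> (x, ys)"
        unfolding rate by (simp only: A_def k_def)
    qed (use A pos C1_0 C2_0 k in auto)
    moreover have "2 * (A * (lam * C1)) * sqrt C\<alpha> * sqrt V \<le> B1 * exp (- (\<mu> / 2) * s)"
    proof -
      have "2 * (A * (lam * C1)) * sqrt C\<alpha> * sqrt V
          \<le> 2 * (A * (lam * C1)) * sqrt C\<alpha> * (sqrt V0 * exp (- (\<mu> / 2) * s))"
        using sqrt_v_decay[OF s] A pos C1_0 C0 by (intro mult_left_mono) (auto simp: v_eq[OF s])
      then show ?thesis by (simp add: B1_def mult_ac)
    qed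
    moreover have "4 * (A * (k * C2 / 2)) * V * C\<alpha> \<le> B2 * exp (- \<mu> * s)"
    proof -
      have "(2 * A * k * C2 * C\<alpha>) * V \<le> (2 * A * k * C2 * C\<alpha>) * (V0 * exp (- \<mu> * s))"
        using v_decay[OF s] A k C2_0 C0 by (intro mult_left_mono) (auto simp: v_eq[OF s])
      then show ?thesis by (simp add: B2_def mult_ac)
    qed
    ultimately show ?thesis by linarith
  qed
  have W_ge: "W0 / 2 \<le> W t" if t: "0 < t" for t
  proof -
    \<comment> \<open>The exponentials are primitives of minus the decay rate, so \<open>?h\<close> is nonincreasing.\<close>
    let ?h = "\<lambda>s. (2 * B1 / \<mu>) * exp (- (\<mu> / 2) * s) + (B2 / \<mu>) * exp (- \<mu> * s) - W s"
    have "?h t \<le> (2 * B1 / \<mu>) * exp (- (\<mu> / 2) * 0) + (B2 / \<mu>) * exp (- \<mu> * 0) - W0"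
    proof (rule nonincreasing_le_initial_limit[OF _ _ _ t])
      show "(?h has_real_derivative - (B1 * exp (- (\<mu> / 2) * s)) - B2 * exp (- \<mu> * s) - ?coll s ?\<omega>) (at s)"
        if "0 < s" for s
        using \<mu>(2) by (auto intro!: derivative_eq_intros W'[OF that])
      show "- (B1 * exp (- (\<mu> / 2) * s)) - B2 * exp (- \<mu> * s) - ?coll s ?\<omega> \<le> 0" if "0 < s" for s
        using W'_ge[OF that] by linarith
    qed (intro tendsto_intros lims)
    moreover have "0 \<le> (2 * B1 / \<mu>) * exp (- (\<mu> / 2) * t) + (B2 / \<mu>) * exp (- \<mu> * t)"
      using B0 \<mu>(2) by simp
    ultimately have "W0 - (2 * B1 + B2) / \<mu> \<le> W t" by (simp add: add_divide_distrib)
    \<comment> \<open>This is where \<open>\<nu>\<close> comes from: it is the total loss relative to \<open>W0\<close>, with \<open>\<surd>V0\<close> and \<open>V0\<close> both replaced by their maximum.\<close>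
    moreover have "(2 * B1 + B2) / \<mu> \<le> \<nu> * W0"
    proof -
      let ?mx = "max (sqrt V0) V0"
      have "2 * lam * C1 * sqrt C\<alpha> * sqrt V0 + k * C2 * C\<alpha> * V0
          \<le> 2 * lam * C1 * sqrt C\<alpha> * ?mx + k * C2 * C\<alpha> * ?mx"
        using pos C1_0 C2_0 C0 k by (intro add_mono mult_left_mono) auto
      then have "2 * A * (2 * lam * C1 * sqrt C\<alpha> * sqrt V0 + k * C2 * C\<alpha> * V0)
          \<le> 2 * A * ((2 * lam * C1 * sqrt C\<alpha> + k * C2 * C\<alpha>) * ?mx)"
        using A by (intro mult_left_mono) (auto simp: distrib_right)
      moreover have "2 * B1 + B2 = 2 * A * (2 * lam * C1 * sqrt C\<alpha> * sqrt V0 + k * C2 * C\<alpha> * V0)"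
        by (simp add: B1_def B2_def algebra_simps)
      ultimately have "(2 * B1 + B2) / \<mu> \<le> 2 * A * ((2 * lam * C1 * sqrt C\<alpha> + k * C2 * C\<alpha>) * ?mx) / \<mu>"
        using \<mu>(2) by (intro divide_right_mono) auto
      also have "\<dots> = \<nu> * W0"
        using W0 \<mu>(2) by (simp add: \<nu>(1) W0_def[symmetric] V0_def[symmetric] A_def k_def[symmetric])
      finally show ?thesis .
    qed
    moreover have "\<nu> * W0 \<le> W0 / 2" using \<nu>(2) W0 mult_right_mono[of \<nu> "1/2" W0] by simp
    ultimately show ?thesis by linarith
  qed

  have "W0 / 2 \<le> ?\<omega> xt"
  proof (rule tendsto_lowerbound)
    show "((\<lambda>t. ?\<omega> xt + A * C1 * sqrt (2 * v t + (norm (density_mean (g t) - xt))\<^sup>2)) \<longlongrightarrow> ?\<omega> xt) at_top"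
    proof -
      have "((\<lambda>t. ?\<omega> xt + A * C1 * sqrt (2 * v t + (norm (density_mean (g t) - xt))\<^sup>2))
          \<longlongrightarrow> ?\<omega> xt + A * C1 * sqrt (2 * 0 + (norm (xt - xt))\<^sup>2)) at_top"
        by (intro tendsto_intros m_lim v_tendsto)
      then show ?thesis by simp
    qed
    show "\<forall>\<^sub>F t in at_top. W0 / 2 \<le> ?\<omega> xt + A * C1 * sqrt (2 * v t + (norm (density_mean (g t) - xt))\<^sup>2)"
      using eventually_gt_at_top[of 0]
    proof eventually_elim
      case (elim t)
      have "?\<omega> x \<le> ?\<omega> xt + A * C1 * norm (x - xt)" for x
      proof -
        have "f xt \<le> f x + C1 * norm (x - xt)" using regularity(1)[of xt x] by (simp add: norm_minus_commute)
        from exp_neg_step_lower_bound[OF pos(3) this]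
        have "?\<omega> x \<le> ?\<omega> xt + ?\<omega> x * (\<alpha> * (C1 * norm (x - xt)))" by (simp add: algebra_simps)
        also have "?\<omega> x * (\<alpha> * (C1 * norm (x - xt))) \<le> exp (- \<alpha> * flo) * (\<alpha> * (C1 * norm (x - xt)))"
          using f_ge[of x] pos C1_0 by (intro mult_right_mono) auto
        finally show ?thesis by (simp add: A_def mult_ac)
      qed
      then have "W t \<le> ?\<omega> xt + A * C1 * sqrt (2 * density_V (g t) + (norm (density_mean (g t) - xt))\<^sup>2)"
        unfolding W_def using A C1_0 \<omega>_int(2)[OF elim]
        by (intro square_integrable_density.integral_le_of_lipschitz_bound[OF displacement.axioms(1)[OF disp[OF elim]]]) auto
      then show ?case using W_ge[OF elim] v_eq[OF elim] by simp
    qed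
  qed simp
  then have "ln (W0 / 2) \<le> - \<alpha> * f xt"
    using W0 by (metis exp_gt_zero half_gt_zero ln_exp ln_le_cancel_iff)
  then have "\<alpha> * f xt \<le> ln 2 - ln W0" using W0 by (simp add: ln_div)
  then have "f xt \<le> (ln 2 - ln W0) / \<alpha>" using pos by (simp add: pos_le_divide_eq mult.commute)
  also have "\<dots> = f xmin + laplace_gap f g0 xmin \<alpha> + ln 2 / \<alpha>"
    by (simp add: laplace_gap_def W0_def diff_divide_distrib)
  finally show ?thesis
    using m_lim laplace_principle[OF g0 f_cont xmin] by blast
qed

end
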